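(* Let $m\ge 2$ and consider the billiard on the torus $\mathbb{T}^m=\mathbb{R}^m/\mathbb{Z}^m$ with one small obstacle $O$. Then the rotation vectors of periodic orbits of admissible type are dense in the admissible rotation set $AR$.
   Context: Setting: the obstacle $O$ on $\mathbb{T}^m$ lifts to a family of pairwise disjoint sets $O_{\mathbf{k}}=O_{\mathbf{0}}+\mathbf{k}$, $\mathbf{k}\in\mathbb{Z}^m$, in $\mathbb{R}^m$, where $O_{\mathbf{0}}$ is compact, has nonempty interior and smooth boundary, and is strictly convex (convex, with boundary containing no straight line segment). $O$ is small if it is contained in a closed ball of radius smaller than $\sqrt{2}/4$ (the lifting is then chosen so that $O_{\mathbf{k}}$ is contained in such a ball centered at $\mathbf{k}$). Billiard trajectories move with unit speed along straight lines outside the interiors of the obstacles and reflect from obstacle boundaries with angle of incidence equal to angle of reflection; trajectories are lifted to $\mathbb{R}^m$, and the time along a trajectory piece equals its length. A tangency is not counted as a reflection. Admissibility: $O_{\mathbf{k}}$ is between $O_{\mathbf{i}}$ and $O_{\mathbf{j}}$ if $\mathbf{k}\ne\mathbf{i},\mathbf{j}$ and $O_{\mathbf{k}}$ intersects the convex hull of $O_{\mathbf{i}}\cup O_{\mathbf{j}}$. A (finite or infinite) sequence $(\mathbf{k}_n)_{n\ge 0}$ in $\mathbb{Z}^m$ is admissible if (1) $\mathbf{k}_0=\mathbf{0}$; (2) $\mathbf{k}_{n+1}\ne\mathbf{k}_n$ for every $n$; (3) for every $n$ there is no obstacle between $O_{\mathbf{k}_n}$ and $O_{\mathbf{k}_{n+1}}$;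 (4) for every $n$ the obstacle $O_{\mathbf{k}_{n+1}}$ is not between $O_{\mathbf{k}_n}$ and $O_{\mathbf{k}_{n+2}}$. A trajectory starting on the boundary of $O$ has type $(\mathbf{k}_n)_{n=0}^\infty$ if $\mathbf{k}_0=\mathbf{0}$ and its continuous lifting starting on the boundary of $O_{\mathbf{k}_0}$ reflects consecutively from $O_{\mathbf{k}_1},O_{\mathbf{k}_2},\dots$; a trajectory piece in $\mathbb{R}^m$ has type $(\mathbf{k}_n)_{n=0}^s$ if it starts on the boundary of $O_{\mathbf{k}_0}$, reflects consecutively from $O_{\mathbf{k}_1},\dots,O_{\mathbf{k}_{s-1}}$ and ends on the boundary of $O_{\mathbf{k}_s}$ (translating so that $\mathbf{k}_0=\mathbf{0}$). A periodic orbit is of admissible type if its type, started at one of its reflections, is an admissible sequence. The admissible rotation set $AR$ is the set of all limits of sequences $((\mathbf{y}_n-\mathbf{x}_n)/t_n)_{n=1}^\infty$ such that there is a trajectory piece of admissible type in $\mathbb{R}^m$ from $\mathbf{x}_n$ to $\mathbf{y}_n$ of length $t_n$, and $t_n\to\infty$. The rotation vector of a trajectory $t\mapsto T(t)\in\mathbb{R}^m$ is $\lim_{t\to\infty}(T(t)-T(0))/t$, if it exists; for a periodic orbit (in the phase space) of period $s$ it equals $(T(s)-T(0))/s$. *)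

theory Defs
  imports "HOL-Analysis.Analysis" "HOL-Library.Extended_Nat"
begin

section \<open>Obstacles\<close>

definition lattice_point :: "int ^ 'm \<Rightarrow> real ^ 'm"
  where "lattice_point k = (\<chi> i. of_int (k $ i))"

text \<open>The obstacle on the torus is given by one of its lifts \<open>B\<close>, so that
  \<open>lift_obst B k\<close> is the obstacle with index \<open>k\<close> in the covering space.\<close>

definition lift_obst :: "(real ^ 'm) set \<Rightarrow> int ^ 'm \<Rightarrow> (real ^ 'm) set"
  where "lift_obst B k = (\<lambda>x. x + lattice_point k) ` B"

text \<open>For open \<open>S\<close> and a finite-dimensional domain this is the class of functions that are
  \<open>k\<close> times continuously differentiable on \<open>S\<close>.\<close>

primrec Ck_on :: "nat \<Rightarrow> ('a::real_normed_vector \<Rightarrow> real) \<Rightarrow> 'a set \<Rightarrow> bool"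
  where
    "Ck_on 0 g S \<longleftrightarrow> continuous_on S g"
  | "Ck_on (Suc k) g S \<longleftrightarrow>
       g differentiable_on S \<and> (\<forall>h. Ck_on k (\<lambda>x. frechet_derivative g (at x) h) S)"

definition local_defining_function ::
    "'a::euclidean_space set \<Rightarrow> 'a \<Rightarrow> 'a set \<Rightarrow> ('a \<Rightarrow> real) \<Rightarrow> bool"
  where "local_defining_function B p U g \<longleftrightarrow>
    open U \<and> p \<in> U \<and> (\<forall>k. Ck_on k g U) \<and>
    (\<forall>x\<in>U. frechet_derivative g (at x) \<noteq> (\<lambda>h. 0)) \<and>
    B \<inter> U = {x \<in> U. g x \<le> 0}"

definition smooth_boundary :: "'a::euclidean_space set \<Rightarrow> bool"
  where "smooth_boundary B \<longleftrightarrow> (\<forall>p\<in>frontier B. \<exists>U g. local_defining_function B p U g)"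

definition outward_unit_normal :: "'a::euclidean_space set \<Rightarrow> 'a \<Rightarrow> 'a \<Rightarrow> bool"
  where "outward_unit_normal B p \<nu> \<longleftrightarrow> p \<in> frontier B \<and>
    (\<exists>U g D. local_defining_function B p U g \<and> GDERIV g p :> D \<and> \<nu> = sgn D)"

definition strictly_convex :: "'a::euclidean_space set \<Rightarrow> bool"
  where "strictly_convex B \<longleftrightarrow>
    convex B \<and> (\<forall>a b. a \<noteq> b \<longrightarrow> \<not> closed_segment a b \<subseteq> frontier B)"

definition obstacle :: "(real ^ 'm) set \<Rightarrow> bool"
  where "obstacle B \<longleftrightarrow>
    compact B \<and> interior B \<noteq> {} \<and> smooth_boundary B \<and> strictly_convex B \<and>
    (\<forall>k l. k \<noteq> l \<longrightarrow> lift_obst B k \<inter> lift_obst B l = {})"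

text \<open>For a small obstacle the lift is chosen so that the enclosing ball is centered at the
  lattice point.\<close>

definition small_obstacle :: "(real ^ 'm) set \<Rightarrow> bool"
  where "small_obstacle B \<longleftrightarrow> obstacle B \<and> (\<exists>r < sqrt 2 / 4. B \<subseteq> cball 0 r)"


section \<open>Billiard trajectories in the covering space\<close>

definition arrives_with :: "(real \<Rightarrow> 'a::euclidean_space) \<Rightarrow> real \<Rightarrow> 'a \<Rightarrow> bool"
  where "arrives_with T t u \<longleftrightarrow>
    norm u = 1 \<and> (\<forall>\<^sub>F s in at_left t. T s = T t + (s - t) *\<^sub>R u)"

definition departs_with :: "(real \<Rightarrow> 'a::euclidean_space) \<Rightarrow> real \<Rightarrow> 'a \<Rightarrow> bool"
  where "departs_with T t v \<longleftrightarrow>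
    norm v = 1 \<and> (\<forall>\<^sub>F s in at_right t. T s = T t + (s - t) *\<^sub>R v)"

text \<open>The strict inequality excludes tangencies, which are not reflections.\<close>

definition reflects_at ::
    "(real ^ 'm) set \<Rightarrow> (real \<Rightarrow> real ^ 'm) \<Rightarrow> int ^ 'm \<Rightarrow> real \<Rightarrow> bool"
  where "reflects_at B T k t \<longleftrightarrow>
    (\<exists>u v \<nu>. arrives_with T t u \<and> departs_with T t v \<and>
       outward_unit_normal (lift_obst B k) (T t) \<nu> \<and>
       u \<bullet> \<nu> < 0 \<and> v = u - (2 * (u \<bullet> \<nu>)) *\<^sub>R \<nu>)"

text \<open>\<open>I\<close> is the time interval. Being affine on both sides of every time, a trajectory has only
  finitely many reflections in each compact part of \<open>I\<close>.\<close>

definition billiard_trajectory ::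
    "(real ^ 'm) set \<Rightarrow> real set \<Rightarrow> (real \<Rightarrow> real ^ 'm) \<Rightarrow> bool"
  where "billiard_trajectory B I T \<longleftrightarrow>
    is_interval I \<and>
    (\<forall>t\<in>I. \<forall>k. T t \<notin> interior (lift_obst B k)) \<and>
    (\<forall>t\<in>I. (\<exists>s\<in>I. s < t) \<longrightarrow> (\<exists>u. arrives_with T t u)) \<and>
    (\<forall>t\<in>I. (\<exists>s\<in>I. t < s) \<longrightarrow> (\<exists>v. departs_with T t v)) \<and>
    (\<forall>t\<in>interior I.
       (\<exists>u. arrives_with T t u \<and> departs_with T t u) \<or> (\<exists>k. reflects_at B T k t))"

definition has_rotation_vector :: "(real \<Rightarrow> 'a::euclidean_space) \<Rightarrow> 'a \<Rightarrow> bool"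
  where "has_rotation_vector T \<rho> \<longleftrightarrow> ((\<lambda>t. (T t - T 0) /\<^sub>R t) \<longlongrightarrow> \<rho>) at_top"


section \<open>Admissible types\<close>

definition between :: "(real ^ 'm) set \<Rightarrow> int ^ 'm \<Rightarrow> int ^ 'm \<Rightarrow> int ^ 'm \<Rightarrow> bool"
  where "between B k i j \<longleftrightarrow>
    k \<noteq> i \<and> k \<noteq> j \<and> lift_obst B k \<inter> convex hull (lift_obst B i \<union> lift_obst B j) \<noteq> {}"

text \<open>The sequence is \<open>\<kappa> 0, \<dots>, \<kappa> N\<close>; it is infinite if \<open>N = \<infinity>\<close>.\<close>

definition admissible :: "(real ^ 'm) set \<Rightarrow> enat \<Rightarrow> (nat \<Rightarrow> int ^ 'm) \<Rightarrow> bool"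
  where "admissible B N \<kappa> \<longleftrightarrow>
    \<kappa> 0 = 0 \<and>
    (\<forall>n. enat (n + 1) \<le> N \<longrightarrow> \<kappa> (n + 1) \<noteq> \<kappa> n) \<and>
    (\<forall>n. enat (n + 1) \<le> N \<longrightarrow> \<not> (\<exists>k. between B k (\<kappa> n) (\<kappa> (n + 1)))) \<and>
    (\<forall>n. enat (n + 2) \<le> N \<longrightarrow> \<not> between B (\<kappa> (n + 1)) (\<kappa> n) (\<kappa> (n + 2)))"

text \<open>The reflections at times in \<open>J\<close> are, in order, from the obstacles \<open>\<kappa> n\<close> with \<open>n \<in> A\<close>.\<close>

definition reflects_consecutively ::
    "(real ^ 'm) set \<Rightarrow> (real \<Rightarrow> real ^ 'm) \<Rightarrow> real set \<Rightarrow> nat set \<Rightarrow> (nat \<Rightarrow> int ^ 'm) \<Rightarrow> bool"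
  where "reflects_consecutively B T J A \<kappa> \<longleftrightarrow>
    (\<exists>\<tau>. strict_mono_on A \<tau> \<and> {t \<in> J. \<exists>k. reflects_at B T k t} = \<tau> ` A \<and>
       (\<forall>n\<in>A. reflects_at B T (\<kappa> n) (\<tau> n)))"

text \<open>Types are taken up to a translation by an integer vector \<open>j\<close>.\<close>

definition piece_has_type ::
    "(real ^ 'm) set \<Rightarrow> (real \<Rightarrow> real ^ 'm) \<Rightarrow> real \<Rightarrow> nat \<Rightarrow> (nat \<Rightarrow> int ^ 'm) \<Rightarrow> bool"
  where "piece_has_type B T L s \<kappa> \<longleftrightarrow>
    0 \<le> L \<and> billiard_trajectory B {0..L} T \<and>
    (\<exists>j. T 0 \<in> frontier (lift_obst B (j + \<kappa> 0)) \<and>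
         T L \<in> frontier (lift_obst B (j + \<kappa> s)) \<and>
         reflects_consecutively B T {0<..<L} {1..<s} (\<lambda>n. j + \<kappa> n))"

definition trajectory_has_type ::
    "(real ^ 'm) set \<Rightarrow> (real \<Rightarrow> real ^ 'm) \<Rightarrow> (nat \<Rightarrow> int ^ 'm) \<Rightarrow> bool"
  where "trajectory_has_type B T \<kappa> \<longleftrightarrow>
    billiard_trajectory B {0..} T \<and>
    (\<exists>j. T 0 \<in> frontier (lift_obst B (j + \<kappa> 0)) \<and>
         reflects_consecutively B T {0<..} {1..} (\<lambda>n. j + \<kappa> n))"

text \<open>Periodicity on the torus (of positions and velocities) is periodicity of the lift up to a
  fixed integer vector.\<close>

definition periodic_orbit :: "(real ^ 'm) set \<Rightarrow> (real \<Rightarrow> real ^ 'm) \<Rightarrow> bool"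
  where "periodic_orbit B T \<longleftrightarrow>
    billiard_trajectory B UNIV T \<and>
    (\<exists>s > 0. \<exists>p. \<forall>t. T (t + s) = T t + lattice_point p)"

definition admissible_periodic_orbit :: "(real ^ 'm) set \<Rightarrow> (real \<Rightarrow> real ^ 'm) \<Rightarrow> bool"
  where "admissible_periodic_orbit B T \<longleftrightarrow>
    periodic_orbit B T \<and>
    (\<exists>t\<^sub>0 i \<kappa>. reflects_at B T i t\<^sub>0 \<and>
       trajectory_has_type B (\<lambda>t. T (t\<^sub>0 + t)) \<kappa> \<and> admissible B \<infinity> \<kappa>)"

definition admissible_rotation_set :: "(real ^ 'm) set \<Rightarrow> (real ^ 'm) set"
  where "admissible_rotation_set B =
    {\<rho>. \<exists>T L s \<kappa>.
       (\<forall>n. piece_has_type B (T n) (L n) (s n) (\<kappa> n) \<and> admissible B (enat (s n)) (\<kappa> n)) \<and>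
       filterlim L at_top sequentially \<and>
       (\<lambda>n::nat. (T n (L n) - T n 0) /\<^sub>R L n) \<longlonglongrightarrow> \<rho>}"

end

theory Submission
  imports Defs
begin

text \<open>
  Why it is true. The rotation vector of an orbit or of a long piece is the ratio of its displacement
  and its length, so both inclusions only need orbits and pieces whose displacements and lengths
  differ by a bounded amount.

  A periodic orbit of admissible type is cut at its successive reflections. Reflection times cannot
  accumulate, because a trajectory is affine just before every time; hence the lengths of these
  pieces tend to infinity and their ratios tend to the rotation vector of the orbit.

  Conversely, let a piece of admissible type \<open>\<kappa> 0, \<dots>, \<kappa> s\<close> and of large length \<open>L\<close> be given.

  \<^item> \<^emph>\<open>Closing the type\<close> (\<open>admissible_closing\<close>). For a small obstacle, consecutive steps with a
    nonpositive inner product are always allowed, and so are steps to a nearest lattice point. In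
    dimension at least two, three such steps connect any last step to any first step. So every
    finite admissible sequence begins a periodic one with period \<open>s + 3\<close>.

  \<^item> \<^emph>\<open>Realizing the periodic type\<close> (\<open>shortest_chain_orbit\<close>). Among the closed chains of points, one
    in each obstacle of the periodic sequence, there is a shortest one. At a minimum over a convex
    body with a smooth boundary the law of reflection holds (\<open>reflection_at_minimum\<close>). Admissibility
    and the supporting hyperplanes at the vertices keep its legs out of all interiors, so the
    shortest chain is a billiard orbit.

  \<^item> \<^emph>\<open>Pieces are shortest as well\<close> (\<open>piece_polygon\<close>). Path length is a convex function of the vertices,
    and the law of reflection is its first order condition on a product of convex sets. Hence a
    piece of a billiard trajectory minimizes the length among all broken lines with the same
    endpoints and vertices in the same obstacles.

  Since the piece and the orbit are both minimal, and the diameters of the obstacles and the three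
  extra steps are bounded, each of them is at most a constant longer than the other one
  (\<open>admissible_piece_shadowed_by_periodic_orbit\<close>). Their displacements also differ by at most a
  constant. Thus the two ratios become arbitrarily close as \<open>L\<close> grows.
\<close>

section \<open>Obstacles and their outward normals\<close>

lemma lattice_point_0 [simp]: "lattice_point 0 = 0"
  by (simp add: lattice_point_def vec_eq_iff)

lemma lattice_point_add: "lattice_point (k + l) = lattice_point k + lattice_point l"
  by (simp add: lattice_point_def vec_eq_iff)

lemma lattice_point_diff: "lattice_point (k - l) = lattice_point k - lattice_point l"
  by (simp add: lattice_point_def vec_eq_iff)

lemma mem_lift_obst: "x \<in> lift_obst B k \<longleftrightarrow> x - lattice_point k \<in> B"
  by (force simp: lift_obst_def image_iff)

lemma add_mem_lift_obst: "x + lattice_point p \<in> lift_obst B (k + p) \<longleftrightarrow> x \<in> lift_obst B k"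
  by (simp add: mem_lift_obst lattice_point_add)

lemma has_derivative_translate:
  fixes g :: "'a::real_normed_vector \<Rightarrow> 'b::real_normed_vector"
  shows "((\<lambda>x. g (x - a)) has_derivative D) (at x) \<longleftrightarrow> (g has_derivative D) (at (x - a))"
proof
  assume "((\<lambda>x. g (x - a)) has_derivative D) (at x)"
  then have "((\<lambda>x. g (x - a)) has_derivative D) (at (x - a + a))" by simp
  moreover have "((\<lambda>z. z + a) has_derivative (\<lambda>h. h)) (at (x - a))"
    by (auto intro!: derivative_eq_intros)
  ultimately have "((\<lambda>z. g (z + a - a)) has_derivative (\<lambda>h. D h)) (at (x - a))"
    by (rule has_derivative_compose[rotated])
  then show "(g has_derivative D) (at (x - a))" by simp
next
  assume "(g has_derivative D) (at (x - a))"
  moreover have "((\<lambda>z. z - a) has_derivative (\<lambda>h. h)) (at x)"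
    by (auto intro!: derivative_eq_intros)
  ultimately have "((\<lambda>z. g (z - a)) has_derivative (\<lambda>h. D h)) (at x)"
    by (rule has_derivative_compose[rotated])
  then show "((\<lambda>x. g (x - a)) has_derivative D) (at x)" by simp
qed

lemma frechet_derivative_translate:
  "frechet_derivative (\<lambda>x. g (x - a)) (at x) = frechet_derivative g (at (x - a))"
  unfolding frechet_derivative_def has_derivative_translate ..

text \<open>The definition of a smooth boundary is not visibly invariant under translations; this lemma and the
  next ones transport it from the obstacle to all its lifts.\<close>

lemma Ck_on_translate:
  assumes "open S" "Ck_on k g S"
  shows "Ck_on k (\<lambda>x. g (x - a)) ((\<lambda>x. x + a) ` S)"
  using assms(2)
proof (induction k arbitrary: g)
  case 0
  then show ?case
    by (auto intro!: continuous_on_compose2[of S g] continuous_intros)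
next
  case (Suc k)
  have "open ((\<lambda>x. x + a) ` S)"
    using open_translation[OF assms(1), of a] by (simp add: add.commute)
  then have "(\<lambda>x. g (x - a)) differentiable_on (\<lambda>x. x + a) ` S"
    using Suc.prems assms(1)
    by (auto simp: differentiable_on_eq_differentiable_at differentiable_def
        has_derivative_translate)
  then show ?case
    using Suc.prems Suc.IH[of "\<lambda>x. frechet_derivative g (at x) h" for h]
    by (auto simp: frechet_derivative_translate)
qed

lemma local_defining_function_translate:
  assumes "local_defining_function B p U g"
  shows "local_defining_function ((\<lambda>x. x + a) ` B) (p + a) ((\<lambda>x. x + a) ` U) (\<lambda>x. g (x - a))"
proof -
  have U: "open U" using assms by (simp add: local_defining_function_def)
  then have "open ((\<lambda>x. x + a) ` U)"
    using open_translation[OF U, of a] by (simp add: add.commute)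
  moreover have "(\<lambda>x. x + a) ` B \<inter> (\<lambda>x. x + a) ` U = (\<lambda>x. x + a) ` (B \<inter> U)"
    by auto
  moreover have "(\<lambda>x. x + a) ` {x \<in> U. g x \<le> 0} = {x \<in> (\<lambda>x. x + a) ` U. g (x - a) \<le> 0}"
    by (auto simp: image_iff)
  ultimately show ?thesis
    using assms U Ck_on_translate[OF U]
    by (auto simp: local_defining_function_def frechet_derivative_translate)
qed

lemma lift_obst_translation: "lift_obst B k = (+) (lattice_point k) ` B"
  by (simp add: lift_obst_def add.commute)

lemma compact_lift_obst: "compact B \<Longrightarrow> compact (lift_obst B k)"
  unfolding lift_obst_translation by (rule compact_translation)

lemma convex_lift_obst: "convex B \<Longrightarrow> convex (lift_obst B k)"
  unfolding lift_obst_translation by (rule convex_translation)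

lemma smooth_boundary_lift_obst:
  assumes "smooth_boundary B"
  shows "smooth_boundary (lift_obst B k)"
proof -
  have "\<exists>U g. local_defining_function (lift_obst B k) q U g" if q: "q \<in> frontier (lift_obst B k)" for q
  proof -
    have "q \<in> (+) (lattice_point k) ` frontier B"
      using q unfolding lift_obst_translation by (simp add: frontier_translation)
    then obtain p where p: "p \<in> frontier B" "q = p + lattice_point k" by (auto simp: add.commute)
    then obtain U g where "local_defining_function B p U g"
      using assms by (auto simp: smooth_boundary_def)
    from local_defining_function_translate[OF this, of "lattice_point k"] show ?thesis
      using p by (auto simp: lift_obst_def)
  qed
  then show ?thesis by (simp add: smooth_boundary_def)
qed

text \<open>The gradient is the vector that represents the derivative by Riesz' theorem.\<close>

lemma local_defining_function_gradient:
  assumes "local_defining_function B p U g"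
  obtains D where "GDERIV g p :> D" "D \<noteq> 0"
proof -
  have U: "open U" "p \<in> U" and nz: "frechet_derivative g (at p) \<noteq> (\<lambda>h. 0)"
    and "Ck_on (Suc 0) g U"
    using assms unfolding local_defining_function_def by blast+
  then have "g differentiable (at p)"
    by (auto simp: differentiable_on_eq_differentiable_at)
  then have d: "(g has_derivative frechet_derivative g (at p)) (at p)"
    by (simp add: frechet_derivative_works)
  define D where "D = (\<Sum>b\<in>Basis. frechet_derivative g (at p) b *\<^sub>R b)"
  have lin: "linear (frechet_derivative g (at p))"
    using d by (rule has_derivative_linear)
  have eq: "frechet_derivative g (at p) h = h \<bullet> D" for h
  proof -
    have "frechet_derivative g (at p) h = frechet_derivative g (at p) (\<Sum>b\<in>Basis. (h \<bullet> b) *\<^sub>R b)"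
      by (simp add: euclidean_representation)
    also have "\<dots> = (\<Sum>b\<in>Basis. (h \<bullet> b) * frechet_derivative g (at p) b)"
      by (simp add: linear_sum[OF lin] linear_scale[OF lin])
    also have "\<dots> = h \<bullet> D"
      by (simp add: D_def inner_sum_right mult.commute)
    finally show ?thesis .
  qed
  have "GDERIV g p :> D" using d unfolding gderiv_def eq[abs_def] .
  moreover have "D \<noteq> 0" using nz eq by auto
  ultimately show ?thesis using that by blast
qed

lemma local_defining_function_gradient_nonzero:
  assumes "local_defining_function B p U g" "GDERIV g p :> D"
  shows "D \<noteq> 0"
proof -
  obtain D' where D': "GDERIV g p :> D'" "D' \<noteq> 0"
    using local_defining_function_gradient[OF assms(1)] .
  have "(\<lambda>h. h \<bullet> D) = (\<lambda>h. h \<bullet> D')"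
    using assms(2) D'(1) unfolding gderiv_def by (rule has_derivative_unique)
  then show ?thesis using D'(2) by (metis inner_eq_zero_iff inner_zero_right)
qed

lemma GDERIV_difference_quotient:
  assumes "GDERIV g p :> D"
  shows "((\<lambda>t. (g (p + t *\<^sub>R h) - g p) / t) \<longlongrightarrow> h \<bullet> D) (at_right 0)"
proof -
  have g: "(g has_derivative (\<lambda>h. h \<bullet> D)) (at (p + 0 *\<^sub>R h))"
    using assms by (simp add: gderiv_def)
  have "((\<lambda>t. p + t *\<^sub>R h) has_derivative (\<lambda>t. t *\<^sub>R h)) (at 0)"
    by (auto intro!: derivative_eq_intros)
  from has_derivative_compose[OF this g]
  have "((\<lambda>t. g (p + t *\<^sub>R h)) has_derivative (\<lambda>t. t * (h \<bullet> D))) (at 0)"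
    by simp
  then have "((\<lambda>t. g (p + t *\<^sub>R h)) has_field_derivative (h \<bullet> D)) (at 0)"
    by (simp add: has_field_derivative_def mult.commute[of _ "h \<bullet> D"])
  then have "((\<lambda>t. (g (p + t *\<^sub>R h) - g p) / t) \<longlongrightarrow> h \<bullet> D) (at 0)"
    by (simp add: DERIV_def)
  then show ?thesis by (rule filterlim_mono) (auto simp: at_within_le_at)
qed

lemma local_defining_function_le_0:
  assumes "local_defining_function B p U g" "x \<in> U"
  shows "x \<in> B \<longleftrightarrow> g x \<le> 0"
  using assms by (auto simp: local_defining_function_def)

text \<open>If the value were negative it would be negative near the point, by continuity, and the point would
  be interior.\<close>

lemma local_defining_function_frontier:
  assumes "local_defining_function B p U g" "p \<in> frontier B" "closed B"
  shows "g p = 0"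
proof (rule ccontr)
  assume "g p \<noteq> 0"
  have U: "open U" "p \<in> U" and c: "continuous_on U g"
    using assms(1) by (auto simp: local_defining_function_def dest!: spec[of _ 0])
  have "p \<in> B" using assms(2,3) by (simp add: frontier_def)
  then have "g p < 0"
    using local_defining_function_le_0[OF assms(1) U(2)] \<open>g p \<noteq> 0\<close> by simp
  have "open (g -` {..<0} \<inter> U)"
    using c U(1) by (auto simp: continuous_on_open_vimage)
  moreover have "p \<in> g -` {..<0} \<inter> U" "g -` {..<0} \<inter> U \<subseteq> B"
    using U(2) \<open>g p < 0\<close> local_defining_function_le_0[OF assms(1)] by auto
  ultimately have "p \<in> interior B" by (rule interiorI)
  then show False using assms(2) by (simp add: frontier_def)
qed

text \<open>The defining function vanishes at the boundary point and is nonpositive along the segment to any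
  other point of the convex set, so its derivative in that direction is nonpositive.\<close>

lemma outward_unit_normal_supports:
  assumes "outward_unit_normal B p \<nu>" "convex B" "closed B" "y \<in> B"
  shows "\<nu> \<bullet> (y - p) \<le> 0"
proof -
  obtain U g D where p: "p \<in> frontier B" and g: "local_defining_function B p U g"
    and D: "GDERIV g p :> D" and \<nu>: "\<nu> = sgn D"
    using assms(1) by (auto simp: outward_unit_normal_def)
  have "g p = 0" using local_defining_function_frontier[OF g p assms(3)] .
  have pB: "p \<in> B" using p assms(3) by (simp add: frontier_def)
  have U: "open U" "p \<in> U" using g by (auto simp: local_defining_function_def)
  have "((\<lambda>t. p + t *\<^sub>R (y - p)) \<longlongrightarrow> p + 0 *\<^sub>R (y - p)) (at_right 0)"
    by (intro tendsto_intros)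
  then have "\<forall>\<^sub>F t in at_right 0. p + t *\<^sub>R (y - p) \<in> U"
    using U by (auto simp: tendsto_def)
  moreover have "\<forall>\<^sub>F t in at_right (0::real). t \<in> {0<..<1}"
    by (rule eventually_at_rightI[of 0 1]) auto
  ultimately have "\<forall>\<^sub>F t in at_right 0. (g (p + t *\<^sub>R (y - p)) - g p) / t \<le> 0"
  proof eventually_elim
    case (elim t)
    have "(1 - t) *\<^sub>R p + t *\<^sub>R y \<in> B"
      using assms(2) pB assms(4) elim(2) by (intro convexD_alt) auto
    then have "p + t *\<^sub>R (y - p) \<in> B" by (simp add: algebra_simps)
    then show ?case
      using local_defining_function_le_0[OF g elim(1)] elim(2) \<open>g p = 0\<close>
      by (simp add: divide_nonpos_pos)
  qed
  then have "(y - p) \<bullet> D \<le> 0"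
    by (intro tendsto_upperbound[OF GDERIV_difference_quotient[OF D]]) auto
  then show ?thesis
    by (simp add: \<nu> sgn_div_norm inner_commute mult_nonneg_nonpos)
qed

lemma norm_outward_unit_normal:
  assumes "outward_unit_normal B p \<nu>"
  shows "norm \<nu> = 1"
  using assms local_defining_function_gradient_nonzero
  by (fastforce simp: outward_unit_normal_def norm_sgn)

text \<open>This is Farkas' lemma for a single half-space. It says that a smooth boundary point has only one
  normal direction.\<close>

lemma halfspace_dual:
  fixes w D :: "'a::real_inner"
  assumes "\<And>h. h \<bullet> D < 0 \<Longrightarrow> 0 \<le> h \<bullet> w" "D \<noteq> 0"
  obtains c where "0 \<le> c" "w = - (c *\<^sub>R D)"
proof -
  define e where "e = w - ((w \<bullet> D) / (D \<bullet> D)) *\<^sub>R D"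
  have DD: "D \<bullet> D > 0" using assms(2) by simp
  have eD: "e \<bullet> D = 0" using DD by (simp add: e_def inner_diff_left)
  have ew: "e \<bullet> w = e \<bullet> e"
  proof -
    have "w = e + ((w \<bullet> D) / (D \<bullet> D)) *\<^sub>R D" by (simp add: e_def)
    then have "e \<bullet> w = e \<bullet> (e + ((w \<bullet> D) / (D \<bullet> D)) *\<^sub>R D)" by simp
    then show ?thesis by (simp add: inner_add_right eD)
  qed
  have "t * (e \<bullet> e) \<le> - (D \<bullet> w)" for t
  proof -
    have "(- t *\<^sub>R e - D) \<bullet> D < 0" using DD eD by (simp add: inner_diff_left)
    from assms(1)[OF this] show ?thesis by (simp add: inner_diff_left ew)
  qed
  from this[of "(1 - D \<bullet> w) / (e \<bullet> e)"] have "e \<bullet> e = 0"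
    by (cases "e \<bullet> e = 0") auto
  then have "w = - ((- (w \<bullet> D) / (D \<bullet> D)) *\<^sub>R D)" by (simp add: e_def)
  moreover have "0 \<le> (- D) \<bullet> w" by (rule assms(1)) (use DD in simp)
  then have "0 \<le> - (w \<bullet> D) / (D \<bullet> D)"
    using DD by (intro divide_nonneg_pos) (auto simp: inner_commute)
  ultimately show ?thesis using that by blast
qed

lemma norm_scaleR_sgn: "norm z *\<^sub>R sgn z = (z :: 'a::real_normed_vector)"
  by (cases "z = 0") (simp_all add: sgn_div_norm)

text \<open>The gradient of \<open>y \<mapsto> dist a y + dist y b\<close> at \<open>x\<close> is the difference \<open>u - v\<close> of the incoming and
  the outgoing direction, and it is nonzero because \<open>x\<close> is off the segment from \<open>a\<close> to \<open>b\<close>.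
  Minimality makes it nonnegative on all directions that point into \<open>K\<close>; by
  \<open>halfspace_dual\<close> it is therefore a negative multiple of the outward normal. For unit vectors this
  is the law of reflection.\<close>

lemma reflection_at_minimum:
  fixes a b x :: "'a::euclidean_space"
  assumes K: "convex K" "closed K" "smooth_boundary K"
    and x: "x \<in> K" and ab: "a \<notin> K" "b \<notin> K" "closed_segment a b \<inter> K = {}"
    and min: "\<And>y. y \<in> K \<Longrightarrow> dist a x + dist x b \<le> dist a y + dist y b"
  obtains \<nu> where "outward_unit_normal K x \<nu>" "sgn (x - a) \<bullet> \<nu> < 0"
    "sgn (b - x) = sgn (x - a) - (2 * (sgn (x - a) \<bullet> \<nu>)) *\<^sub>R \<nu>"
proof -
  define u v where "u = sgn (x - a)" and "v = sgn (b - x)"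
  have xa: "x \<noteq> a" and xb: "x \<noteq> b" using x ab by auto
  have [simp]: "norm u = 1" "norm v = 1" using xa xb by (auto simp: u_def v_def norm_sgn)
  have "((\<lambda>y. norm (y - a) + norm (y - b)) has_derivative (\<lambda>h. h \<bullet> sgn (x - a) + h \<bullet> sgn (x - b))) (at x)"
    using xa xb by (intro has_derivative_add) (simp_all add: has_derivative_translate has_derivative_norm)
  then have grad: "GDERIV (\<lambda>y. norm (y - a) + norm (y - b)) x :> (u - v)"
    unfolding gderiv_def u_def v_def
    by (simp add: inner_diff_right sgn_minus[of "x - b", symmetric] inner_minus_right
        minus_diff_eq del: sgn_minus)
       (simp add: inner_add_right[symmetric] sgn_div_norm norm_minus_commute algebra_simps)
  have local_min: "0 \<le> h \<bullet> (u - v)" if h: "\<forall>\<^sub>F t in at_right 0. x + t *\<^sub>R h \<in> K" for h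
  proof -
    have "\<forall>\<^sub>F t in at_right 0. 0 \<le> ((norm (x + t *\<^sub>R h - a) + norm (x + t *\<^sub>R h - b)) -
        (norm (x - a) + norm (x - b))) / t"
      using h eventually_at_right_less[of "0::real"]
    proof eventually_elim
      case (elim t)
      then show ?case
        using min[OF elim(1)] by (intro divide_nonneg_pos) (auto simp: dist_norm norm_minus_commute)
    qed
    then show ?thesis
      by (intro tendsto_lowerbound[OF GDERIV_difference_quotient[OF grad]]) auto
  qed
  \<comment> \<open>If the directions were equal, the triangle inequality would be an equality at x.\<close>
  have uv: "u \<noteq> v"
  proof
    assume "u = v"
    then have "norm (x - a) *\<^sub>R (b - x) = norm (b - x) *\<^sub>R (x - a)"
      unfolding u_def v_def by (metis norm_scaleR_sgn scaleR_left_commute)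
    then have "norm ((b - x) + (x - a)) = norm (b - x) + norm (x - a)"
      by (subst norm_triangle_eq) auto
    then have "Line_Segment.between (a, b) x"
      by (simp add: Line_Segment.between dist_norm norm_minus_commute)
    then show False using ab(3) x by (auto simp: between_mem_segment)
  qed
  have line: "((\<lambda>t. x + t *\<^sub>R h) \<longlongrightarrow> x) (at_right 0)" for h
  proof -
    have "((\<lambda>t. x + t *\<^sub>R h) \<longlongrightarrow> x + 0 *\<^sub>R h) (at_right 0)" by (intro tendsto_intros)
    then show ?thesis by simp
  qed
  have "x \<notin> interior K"
  proof
    assume "x \<in> interior K"
    then have "\<forall>\<^sub>F t in at_right 0. x + t *\<^sub>R (v - u) \<in> interior K"
      using line[of "v - u"] by (auto simp: tendsto_def)
    then have "\<forall>\<^sub>F t in at_right 0. x + t *\<^sub>R (v - u) \<in> K"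
      by eventually_elim (use interior_subset in blast)
    then have "0 \<le> (v - u) \<bullet> (u - v)" by (rule local_min)
    then have "(u - v) \<bullet> (u - v) \<le> 0" by (simp add: algebra_simps)
    then show False using uv by (simp add: not_less[symmetric])
  qed
  then have fr: "x \<in> frontier K" using x K(2) by (simp add: frontier_def)
  then obtain U g where g: "local_defining_function K x U g"
    using K(3) by (auto simp: smooth_boundary_def)
  then obtain D where D: "GDERIV g x :> D" "D \<noteq> 0" by (rule local_defining_function_gradient)
  have U: "open U" "x \<in> U" using g by (auto simp: local_defining_function_def)
  have gx: "g x = 0" by (rule local_defining_function_frontier[OF g fr K(2)])
  have "0 \<le> h \<bullet> (u - v)" if "h \<bullet> D < 0" for h
  proof (rule local_min)
    have "\<forall>\<^sub>F t in at_right 0. (g (x + t *\<^sub>R h) - g x) / t < 0"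
      using GDERIV_difference_quotient[OF D(1)] that by (rule order_tendstoD)
    moreover have "\<forall>\<^sub>F t in at_right 0. x + t *\<^sub>R h \<in> U"
      using line U by (auto simp: tendsto_def)
    ultimately show "\<forall>\<^sub>F t in at_right 0. x + t *\<^sub>R h \<in> K"
      using eventually_at_right_less[of "0::real"]
    proof eventually_elim
      case (elim t)
      then have "g (x + t *\<^sub>R h) < 0" by (simp add: gx divide_less_0_iff)
      then show ?case using local_defining_function_le_0[OF g elim(2)] by simp
    qed
  qed
  from halfspace_dual[OF this D(2)] obtain c where c: "0 \<le> c" "u - v = - (c *\<^sub>R D)" by blast
  define \<nu> where "\<nu> = sgn D"
  define c' where "c' = c * norm D"
  have \<nu>: "outward_unit_normal K x \<nu>" using fr g D by (auto simp: outward_unit_normal_def \<nu>_def)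
  then have n\<nu>: "\<nu> \<bullet> \<nu> = 1" by (simp add: norm_outward_unit_normal dot_square_norm)
  have v: "v = u + c' *\<^sub>R \<nu>"
    using c(2) D(2) by (simp add: \<nu>_def c'_def sgn_div_norm algebra_simps)
  have "c' \<noteq> 0" using v uv by auto
  then have c': "c' > 0" using c(1) by (simp add: c'_def less_le)
  \<comment> \<open>Both velocities are unit vectors, which determines the coefficient of the normal.\<close>
  have "v \<bullet> v = u \<bullet> u + 2 * c' * (u \<bullet> \<nu>) + c' * c'"
    unfolding v by (simp add: inner_add_left inner_add_right n\<nu> inner_commute algebra_simps)
  then have "c' * (2 * (u \<bullet> \<nu>) + c') = 0" by (simp add: dot_square_norm algebra_simps)
  then have "c' = - (2 * (u \<bullet> \<nu>))" using c' by simp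
  then show ?thesis
    using that[OF \<nu>] c' v unfolding u_def[symmetric] v_def[symmetric] by simp
qed

section \<open>Admissible sequences and how to close them\<close>

lemma between_translate:
  "between B (k + p) (i + p) (j + p) \<longleftrightarrow> between B k i j"
proof -
  have lift: "lift_obst B (l + p) = (+) (lattice_point p) ` lift_obst B l" for l
    by (auto simp: lift_obst_def lattice_point_add image_image algebra_simps)
  have "lift_obst B (k + p) \<inter> convex hull (lift_obst B (i + p) \<union> lift_obst B (j + p)) =
      (+) (lattice_point p) ` (lift_obst B k \<inter> convex hull (lift_obst B i \<union> lift_obst B j))"
    unfolding lift image_Un[symmetric] convex_hull_translation
    by (simp add: image_Int)
  then show ?thesis by (simp add: between_def)
qed

lemma lattice_point_inner_self_ge_1:
  assumes "k \<noteq> 0"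
  shows "1 \<le> lattice_point k \<bullet> lattice_point k"
proof -
  obtain a where "k $ a \<noteq> 0" using assms by (auto simp: vec_eq_iff)
  then have "1 \<le> k $ a * k $ a" by (metis int_one_le_iff_zero_less not_square_less_zero linorder_neqE_linordered_idom mult_eq_0_iff)
  then have "1 \<le> lattice_point k $ a * lattice_point k $ a"
    unfolding lattice_point_def by (metis of_int_1_le_iff of_int_mult vec_lambda_beta)
  also have "\<dots> \<le> (\<Sum>b\<in>UNIV. lattice_point k $ b * lattice_point k $ b)"
    by (rule member_le_sum) auto
  finally show ?thesis by (simp add: inner_vec_def)
qed

text \<open>The one place where the bound on the radius enters. If the angle at \<open>k\<close> between the directions to
  \<open>i\<close> and \<open>j\<close> is at most a right angle, the segment from \<open>i\<close> to \<open>j\<close> stays at distance at least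
  \<open>sqrt 2 / 2\<close> from \<open>k\<close>, because distinct lattice points are at least \<open>1\<close> apart. The convex hull lies
  within \<open>r\<close> of this segment and the obstacle within \<open>r\<close> of \<open>k\<close>, where \<open>2 * r < sqrt 2 / 2\<close>.\<close>

lemma not_between_if_inner_nonneg:
  assumes "convex B" "B \<subseteq> cball 0 r" "r < sqrt 2 / 4"
    and "0 \<le> lattice_point (i - k) \<bullet> lattice_point (j - k)"
  shows "\<not> between B k i j"
proof
  assume b: "between B k i j"
  then obtain z where z: "z \<in> lift_obst B k" "z \<in> convex hull (lift_obst B i \<union> lift_obst B j)"
    and ki: "i - k \<noteq> 0" "j - k \<noteq> 0"
    by (auto simp: between_def)
  have ne: "lift_obst B l \<noteq> {}" for l
    using z(1) by (auto simp: lift_obst_def)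
  obtain u v x y where uv: "0 \<le> u" "0 \<le> v" "u + v = 1"
    and xy: "x \<in> lift_obst B i" "y \<in> lift_obst B j" "z = u *\<^sub>R x + v *\<^sub>R y"
    using z(2) by (auto simp: convex_hull_union_two[OF convex_lift_obst[OF assms(1)] ne
          convex_lift_obst[OF assms(1)] ne])
  have r: "norm (x' - lattice_point l) \<le> r" if "x' \<in> lift_obst B l" for x' l
    using that assms(2) by (auto simp: mem_lift_obst)
  define P Q where "P = lattice_point (i - k)" and "Q = lattice_point (j - k)"
  have "u *\<^sub>R P + v *\<^sub>R Q =
      (z - lattice_point k) - (u *\<^sub>R (x - lattice_point i) + v *\<^sub>R (y - lattice_point j))"
  proof -
    have "u *\<^sub>R lattice_point k + v *\<^sub>R lattice_point k = lattice_point k"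
      using uv(3) by (metis scaleR_left_distrib scaleR_one)
    then show ?thesis
      by (simp add: P_def Q_def lattice_point_diff xy(3) algebra_simps)
  qed
  also have "norm \<dots> \<le> r + (u * r + v * r)"
  proof (rule norm_triangle_le_diff, rule add_mono)
    show "norm (u *\<^sub>R (x - lattice_point i) + v *\<^sub>R (y - lattice_point j)) \<le> u * r + v * r"
      using r[OF xy(1)] r[OF xy(2)] uv
      by (intro norm_triangle_le add_mono) (auto intro!: mult_left_mono)
  qed (rule r[OF z(1)])
  also have "\<dots> = 2 * r" using uv(3) by (simp add: distrib_right[symmetric])
  finally have le: "norm (u *\<^sub>R P + v *\<^sub>R Q) \<le> 2 * r" .
  have "2 * r < sqrt 2 / 2" using assms(3) by simp
  with le have "norm (u *\<^sub>R P + v *\<^sub>R Q) < sqrt 2 / 2" by linarith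
  then have "(norm (u *\<^sub>R P + v *\<^sub>R Q))\<^sup>2 < (sqrt 2 / 2)\<^sup>2"
    by (intro power_strict_mono) auto
  then have "(u *\<^sub>R P + v *\<^sub>R Q) \<bullet> (u *\<^sub>R P + v *\<^sub>R Q) < 1 / 2"
    by (simp add: dot_square_norm power_divide)
  moreover have "(u *\<^sub>R P + v *\<^sub>R Q) \<bullet> (u *\<^sub>R P + v *\<^sub>R Q) =
      u * u * (P \<bullet> P) + v * v * (Q \<bullet> Q) + 2 * (u * v * (P \<bullet> Q))"
    by (simp add: inner_add_left inner_add_right inner_commute algebra_simps)
  moreover have "u * u * 1 \<le> u * u * (P \<bullet> P)" "v * v * 1 \<le> v * v * (Q \<bullet> Q)"
    using lattice_point_inner_self_ge_1[OF ki(1)] lattice_point_inner_self_ge_1[OF ki(2)]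
    by (intro mult_left_mono; simp add: P_def Q_def)+
  moreover have "0 \<le> u * v * (P \<bullet> Q)" using assms(4) uv by (simp add: P_def Q_def)
  moreover have "1 / 2 \<le> u * u + v * v"
  proof -
    have "v = 1 - u" using uv(3) by simp
    then have "2 * (u * u + v * v) = 1 + (2 * u - 1) * (2 * u - 1)"
      by (simp only:) (simp add: algebra_simps)
    then have "1 \<le> 2 * (u * u + v * v)" by (metis le_add_same_cancel1 zero_le_square)
    then show ?thesis by simp
  qed
  ultimately show False by linarith
qed

text \<open>By translation invariance, admissibility depends only on the differences of consecutive indices:
  each of them has to be an admissible step, and each two consecutive ones an admissible turn.\<close>

definition admissible_step :: "(real ^ 'm) set \<Rightarrow> int ^ 'm \<Rightarrow> bool"
  where "admissible_step B l \<longleftrightarrow> l \<noteq> 0 \<and> (\<forall>k. \<not> between B k 0 l)"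

definition admissible_turn :: "(real ^ 'm) set \<Rightarrow> int ^ 'm \<Rightarrow> int ^ 'm \<Rightarrow> bool"
  where "admissible_turn B l l' \<longleftrightarrow> \<not> between B l 0 (l + l')"

lemma admissible_step_diff_iff:
  "admissible_step B (j - i) \<longleftrightarrow> j \<noteq> i \<and> \<not> (\<exists>k. between B k i j)"
proof -
  have "between B k i j \<longleftrightarrow> between B (k - i) 0 (j - i)" for k
    using between_translate[of B "k - i" i 0 "j - i"] by simp
  moreover have "between B k 0 (j - i) \<longleftrightarrow> between B (k + i) i j" for k
    using between_translate[of B k i 0 "j - i"] by simp
  ultimately have "(\<exists>k. between B k 0 (j - i)) \<longleftrightarrow> (\<exists>k. between B k i j)" by blast
  then show ?thesis by (auto simp: admissible_step_def)
qed

lemma admissible_turn_diff_iff: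
  "admissible_turn B (j - i) (l - j) \<longleftrightarrow> \<not> between B j i l"
  using between_translate[of B "j - i" i 0 "l - i"] by (simp add: admissible_turn_def)

lemma admissible_iff_steps:
  "admissible B N \<kappa> \<longleftrightarrow> \<kappa> 0 = 0 \<and>
    (\<forall>n. enat (n + 1) \<le> N \<longrightarrow> admissible_step B (\<kappa> (n + 1) - \<kappa> n)) \<and>
    (\<forall>n. enat (n + 2) \<le> N \<longrightarrow>
      admissible_turn B (\<kappa> (n + 1) - \<kappa> n) (\<kappa> (n + 2) - \<kappa> (n + 1)))"
  unfolding admissible_def admissible_step_diff_iff admissible_turn_diff_iff by blast

lemma lattice_point_axis: "lattice_point (axis a c) = axis a (of_int c)"
  by (simp add: lattice_point_def axis_def vec_eq_iff)

text \<open>For an integer vector \<open>w\<close> the number \<open>w \<bullet> (w - a)\<close> with \<open>a\<close> a signed unit vector is a sum of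
  nonnegative integers, so no obstacle sees both ends of the step under an obtuse angle.\<close>

lemma admissible_step_axis:
  fixes a :: "'m::finite"
  assumes B: "convex B" "B \<subseteq> cball 0 r" "r < sqrt 2 / 4" and c: "\<bar>c\<bar> = 1"
  shows "admissible_step B (axis a c)"
proof -
  have "\<not> between B k 0 (axis a c)" for k
  proof (rule not_between_if_inner_nonneg[OF B])
    have sq: "0 \<le> k $ a * (k $ a - c)"
    proof (cases "k $ a \<le> 0")
      case True
      show ?thesis
      proof (cases "k $ a = 0")
        case False
        then have "k $ a \<le> 0" "k $ a - c \<le> 0" using True c by auto
        then show ?thesis by (rule mult_nonpos_nonpos)
      qed simp
    next
      case False
      then have "0 \<le> k $ a" "0 \<le> k $ a - c" using c by auto
      then show ?thesis by (rule mult_nonneg_nonneg)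
    qed
    have "lattice_point (0 - k) \<bullet> lattice_point (axis a c - k) =
        real_of_int (\<Sum>b\<in>UNIV. k $ b * (k $ b - axis a c $ b))"
      by (simp add: lattice_point_def inner_vec_def algebra_simps)
    moreover have "0 \<le> real_of_int (\<Sum>b\<in>UNIV. k $ b * (k $ b - axis a c $ b))"
      unfolding of_int_0_le_iff
      using sq by (intro sum_nonneg) (auto simp: axis_def)
    ultimately show "0 \<le> lattice_point (0 - k) \<bullet> lattice_point (axis a c - k)" by metis
  qed
  moreover have "axis a c \<noteq> 0" using c by (auto simp: axis_eq_0_iff)
  ultimately show ?thesis by (simp add: admissible_step_def)
qed

lemma admissible_turn_if_inner_nonpos:
  assumes B: "convex B" "B \<subseteq> cball 0 r" "r < sqrt 2 / 4"
    and "lattice_point l \<bullet> lattice_point l' \<le> 0"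
  shows "admissible_turn B l l'"
  unfolding admissible_turn_def
  by (rule not_between_if_inner_nonneg[OF B])
     (use assms(4) lattice_point_diff[of 0 l] in simp)

text \<open>Continues \<open>\<kappa> 0, \<dots>, \<kappa> q\<close> to all integers by repeating its steps, provided that \<open>\<kappa> 0 = 0\<close>.\<close>

definition periodic_extension :: "nat \<Rightarrow> (nat \<Rightarrow> int ^ 'm) \<Rightarrow> int \<Rightarrow> int ^ 'm"
  where "periodic_extension q \<kappa> i = \<kappa> (nat (i mod int q)) + (i div int q) *s \<kappa> q"

lemma periodic_extension_of_nat:
  assumes "0 < q" "\<kappa> 0 = 0" "n \<le> q"
  shows "periodic_extension q \<kappa> (int n) = \<kappa> n"
  using assms by (cases "n = q") (auto simp: periodic_extension_def)

lemma periodic_extension_add_period: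
  assumes "0 < q"
  shows "periodic_extension q \<kappa> (i + int q) = periodic_extension q \<kappa> i + \<kappa> q"
  using assms by (simp add: periodic_extension_def vec_eq_iff algebra_simps)

lemma periodic_extension_step:
  assumes "0 < q" "\<kappa> 0 = 0"
  shows "periodic_extension q \<kappa> (i + 1) - periodic_extension q \<kappa> i =
    \<kappa> (nat (i mod int q) + 1) - \<kappa> (nat (i mod int q))"
proof -
  define r where "r = nat (i mod int q)"
  define d where "d = i div int q"
  have r: "int r = i mod int q" using assms by (simp add: r_def)
  have rq: "r < q" using assms r by (metis of_nat_0_less_iff of_nat_less_iff pos_mod_bound)
  have i: "i = d * int q + int r" by (simp add: r d_def)
  have *: "periodic_extension q \<kappa> (d * int q + int n) = \<kappa> n + d *s \<kappa> q" if "n \<le> q" for n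
  proof (cases "n = q")
    case True
    then have "d * int q + int n = (d + 1) * int q" by (simp add: algebra_simps)
    then show ?thesis
      using assms True by (simp add: periodic_extension_def vec_eq_iff algebra_simps)
  next
    case False
    then show ?thesis using that assms by (simp add: periodic_extension_def)
  qed
  show ?thesis
    using *[of r] *[of "r + 1"] rq unfolding r_def[symmetric] by (simp add: i add.assoc add.commute[of 1])
qed

text \<open>The three new steps are \<open>\<sigma> l, axis \<beta> 1, \<sigma> l'\<close>, where \<open>l\<close> is the last and \<open>l'\<close> the first given step
  and where \<open>\<sigma> x\<close> is the unit vector along the axis \<open>\<alpha> \<noteq> \<beta>\<close> whose sign makes its inner product with
  \<open>x\<close> nonpositive. The step along the orthogonal axis in the middle makes the signs of the outer
  two irrelevant to each other; here the dimension has to be at least two.\<close>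

lemma admissible_closing:
  fixes B :: "(real ^ 'm) set"
  assumes dim: "CARD('m) \<ge> 2" and B: "convex B" "B \<subseteq> cball 0 r" "r < sqrt 2 / 4"
    and s: "1 \<le> s" and adm: "admissible B (enat s) \<kappa>"
  obtains K p where "\<And>n. n \<le> s \<Longrightarrow> K (int n) = \<kappa> n"
    and "\<And>i. K (i + int (s + 3)) = K i + p"
    and "\<And>i. admissible_step B (K (i + 1) - K i)"
    and "\<And>i. admissible_turn B (K (i + 1) - K i) (K (i + 2) - K (i + 1))"
    and "\<And>n. n \<in> {s..<s + 3} \<Longrightarrow> norm (lattice_point (K (int n + 1) - K (int n))) = 1"
proof -
  obtain \<alpha> \<beta> :: 'm where \<alpha>\<beta>: "\<alpha> \<noteq> \<beta>"
    using dim by (meson card_2_iff' ex_card)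
  define \<sigma> where "\<sigma> x = (axis \<alpha> (if x $ \<alpha> \<le> 0 then 1 else - 1) :: int ^ 'm)" for x :: "int ^ 'm"
  define \<kappa>' where "\<kappa>' n =
     (if n \<le> s then \<kappa> n
      else if n = s + 1 then \<kappa> s + \<sigma> (\<kappa> s - \<kappa> (s - 1))
      else if n = s + 2 then \<kappa> s + \<sigma> (\<kappa> s - \<kappa> (s - 1)) + axis \<beta> 1
      else \<kappa> s + \<sigma> (\<kappa> s - \<kappa> (s - 1)) + axis \<beta> 1 + \<sigma> (\<kappa> 1))" for n
  define q where "q = s + 3"
  define K where "K = periodic_extension q \<kappa>'"
  define c where "c n = \<kappa>' (n + 1) - \<kappa>' n" for n
  have \<kappa>0: "\<kappa> 0 = 0" using adm by (simp add: admissible_def)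
  have c_old: "c n = \<kappa> (n + 1) - \<kappa> n" if "n < s" for n using that by (simp add: c_def \<kappa>'_def)
  have c_new: "c s = \<sigma> (c (s - 1))" "c (s + 1) = axis \<beta> 1" "c (s + 2) = \<sigma> (c 0)"
    using s \<kappa>0 by (auto simp: c_def \<kappa>'_def)
  have step: "admissible_step B (c n)" if "n < q" for n
  proof (cases "n < s")
    case True
    then show ?thesis using adm by (simp add: admissible_iff_steps c_old)
  next
    case False
    then have "n = s \<or> n = s + 1 \<or> n = s + 2" using that by (auto simp: q_def)
    then show ?thesis
      using admissible_step_axis[OF B] c_new by (auto simp: \<sigma>_def)
  qed
  have \<sigma>: "lattice_point x \<bullet> lattice_point (\<sigma> x) \<le> 0" for x
    by (simp add: \<sigma>_def lattice_point_axis inner_axis) (simp add: lattice_point_def)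
  have \<beta>: "lattice_point (axis \<beta> 1) \<bullet> lattice_point (\<sigma> x) = 0" for x
    using \<alpha>\<beta> by (simp add: \<sigma>_def lattice_point_axis inner_axis_axis)
  note turnI = admissible_turn_if_inner_nonpos[OF B]
  have turn: "admissible_turn B (c n) (c (if n + 1 < q then n + 1 else 0))" if "n < q" for n
  proof (cases "n + 1 < s")
    case True
    then show ?thesis using adm by (auto simp: admissible_iff_steps c_old q_def)
  next
    case False
    then have "n = s - 1 \<or> n = s \<or> n = s + 1 \<or> n = s + 2"
      using that unfolding q_def by linarith
    then consider "n = s - 1" | "n = s" | "n = s + 1" | "n = s + 2"
      by blast
    then show ?thesis
    proof cases
      case 1
      then have "n + 1 = s" using s by simp
      then show ?thesis using turnI[OF \<sigma>] 1 c_new by (simp add: q_def)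
    next
      case 2
      then show ?thesis using turnI[of "\<sigma> _" "axis \<beta> 1"] c_new \<beta> by (simp add: q_def inner_commute)
    next
      case 3
      then show ?thesis using turnI[of "axis \<beta> 1" "\<sigma> _"] c_new \<beta> by (simp add: q_def)
    next
      case 4
      then show ?thesis using turnI[of "\<sigma> _" "c 0"] \<sigma> c_new by (simp add: q_def inner_commute)
    qed
  qed
  have q: "0 < q" and \<kappa>'0: "\<kappa>' 0 = 0" using \<kappa>0 by (auto simp: q_def \<kappa>'_def)
  have Kstep: "K (i + 1) - K i = c (nat (i mod int q))" for i
    using periodic_extension_step[of q \<kappa>' i] q \<kappa>'0 by (simp add: K_def c_def)
  have mod_less: "nat (i mod int q) < q" for i
    using q by (metis nat_less_iff of_nat_0_less_iff pos_mod_bound pos_mod_sign)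
  show ?thesis
  proof
    show "K (int n) = \<kappa> n" if "n \<le> s" for n
      using periodic_extension_of_nat[of q \<kappa>' n] that q \<kappa>'0 by (simp add: K_def q_def \<kappa>'_def)
    show "K (i + int (s + 3)) = K i + \<kappa>' q" for i
      using periodic_extension_add_period[of q \<kappa>' i] q by (simp add: K_def q_def)
    show "admissible_step B (K (i + 1) - K i)" for i
      using step[OF mod_less] by (simp add: Kstep)
    show "admissible_turn B (K (i + 1) - K i) (K (i + 2) - K (i + 1))" for i
    proof -
      have "nat ((i + 1) mod int q) =
          (if nat (i mod int q) + 1 < q then nat (i mod int q) + 1 else 0)"
      proof -
        have "(i + 1) mod int q = (i mod int q + 1) mod int q" by (simp add: mod_add_left_eq)
        moreover have "0 \<le> i mod int q" "i mod int q < int q" using q by auto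
        ultimately show ?thesis
          by (cases "i mod int q + 1 = int q") (auto simp: nat_add_distrib)
      qed
      then show ?thesis
        using turn[OF mod_less, of i] Kstep[of "i + 1"] by (simp add: Kstep add.assoc)
    qed
    show "norm (lattice_point (K (int n + 1) - K (int n))) = 1" if "n \<in> {s..<s + 3}" for n
    proof -
      have "nat (int n mod int q) = n" using that by (simp add: q_def)
      moreover have "n = s \<or> n = s + 1 \<or> n = s + 2" using that by auto
      moreover have "norm (axis a (x :: real) :: real ^ 'm) = \<bar>x\<bar>" for a x
        by (simp add: norm_eq_sqrt_inner inner_axis_axis)
      ultimately show ?thesis
        using c_new by (auto simp: Kstep \<sigma>_def lattice_point_axis)
    qed
  qed
qed

section \<open>Billiard trajectories between reflections\<close>

lemma arrives_withE:
  assumes "arrives_with T t u"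
  obtains a where "a < t" "\<And>s. a < s \<Longrightarrow> s < t \<Longrightarrow> T s = T t + (s - t) *\<^sub>R u"
proof -
  have "\<exists>a<t. \<forall>s>a. s < t \<longrightarrow> T s = T t + (s - t) *\<^sub>R u"
    using assms unfolding arrives_with_def eventually_at_left_field by simp
  then show ?thesis using that by blast
qed

lemma departs_withE:
  assumes "departs_with T t u"
  obtains b where "t < b" "\<And>s. t < s \<Longrightarrow> s < b \<Longrightarrow> T s = T t + (s - t) *\<^sub>R u"
proof -
  have "\<exists>b>t. \<forall>s>t. s < b \<longrightarrow> T s = T t + (s - t) *\<^sub>R u"
    using assms unfolding departs_with_def eventually_at_right_field by simp
  then show ?thesis using that by blast
qed

lemma arrives_with_unique:
  assumes "arrives_with T t u" "arrives_with T t u'"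
  shows "u = u'"
proof -
  obtain a where a: "a < t" "\<And>s. a < s \<Longrightarrow> s < t \<Longrightarrow> T s = T t + (s - t) *\<^sub>R u"
    using assms(1) by (rule arrives_withE) blast
  obtain a' where a': "a' < t" "\<And>s. a' < s \<Longrightarrow> s < t \<Longrightarrow> T s = T t + (s - t) *\<^sub>R u'"
    using assms(2) by (rule arrives_withE) blast
  obtain s where "max a a' < s" "s < t" using dense[of "max a a'" t] a(1) a'(1) by auto
  then have "(s - t) *\<^sub>R u = (s - t) *\<^sub>R u'" using a(2)[of s] a'(2)[of s] by simp
  then show ?thesis using \<open>s < t\<close> by simp
qed

lemma departs_with_unique:
  assumes "departs_with T t u" "departs_with T t u'"
  shows "u = u'"
proof -
  obtain b where b: "t < b" "\<And>s. t < s \<Longrightarrow> s < b \<Longrightarrow> T s = T t + (s - t) *\<^sub>R u"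
    using assms(1) by (rule departs_withE) blast
  obtain b' where b': "t < b'" "\<And>s. t < s \<Longrightarrow> s < b' \<Longrightarrow> T s = T t + (s - t) *\<^sub>R u'"
    using assms(2) by (rule departs_withE) blast
  obtain s where "t < s" "s < min b b'" using dense[of t "min b b'"] b(1) b'(1) by auto
  then have "(s - t) *\<^sub>R u = (s - t) *\<^sub>R u'" using b(2)[of s] b'(2)[of s] by simp
  then show ?thesis using \<open>t < s\<close> by simp
qed

text \<open>A reflection changes the velocity, since the incoming one is transversal to the boundary.\<close>

lemma straight_not_reflects_at:
  assumes "arrives_with T t u" "departs_with T t u"
  shows "\<not> reflects_at B T k t"
proof
  assume "reflects_at B T k t"
  then obtain u' v \<nu> where r: "arrives_with T t u'" "departs_with T t v"
    "outward_unit_normal (lift_obst B k) (T t) \<nu>" "u' \<bullet> \<nu> < 0"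
    "v = u' - (2 * (u' \<bullet> \<nu>)) *\<^sub>R \<nu>"
    by (auto simp: reflects_at_def)
  have "u' = u" "v = u"
    using r assms arrives_with_unique departs_with_unique by blast+
  with r(5) have "u' \<bullet> \<nu> = 0" by auto
  then show False using r(4) by simp
qed

lemma affine_on_leftI:
  assumes "c < t" "norm u = 1" "\<And>s. c < s \<Longrightarrow> s \<le> t \<Longrightarrow> T s = p + s *\<^sub>R u"
  shows "arrives_with T t u"
  unfolding arrives_with_def
proof
  show "\<forall>\<^sub>F s in at_left t. T s = T t + (s - t) *\<^sub>R u"
    by (rule eventually_at_leftI[OF _ assms(1)]) (use assms(1,3) in \<open>auto simp: algebra_simps\<close>)
qed fact

lemma affine_on_rightI:
  assumes "t < c" "norm u = 1" "\<And>s. t \<le> s \<Longrightarrow> s < c \<Longrightarrow> T s = p + s *\<^sub>R u"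
  shows "departs_with T t u"
  unfolding departs_with_def
proof
  show "\<forall>\<^sub>F s in at_right t. T s = T t + (s - t) *\<^sub>R u"
    by (rule eventually_at_rightI[OF _ assms(1)]) (use assms(1,3) in \<open>auto simp: algebra_simps\<close>)
qed fact

lemma affine_near_not_reflects_at:
  assumes "a < t" "t < b" "norm u = 1" "\<And>s. a < s \<Longrightarrow> s < b \<Longrightarrow> T s = p + s *\<^sub>R u"
  shows "\<not> reflects_at B T k t"
  using assms
  by (intro straight_not_reflects_at[of _ _ u] affine_on_leftI[of a] affine_on_rightI[of _ b]) auto

lemma billiard_arrives:
  assumes "billiard_trajectory B I T" "t \<in> I" "s \<in> I" "s < t"
  obtains u where "arrives_with T t u"
proof -
  have "\<forall>t\<in>I. (\<exists>s\<in>I. s < t) \<longrightarrow> (\<exists>u. arrives_with T t u)"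
    using assms(1) by (simp add: billiard_trajectory_def)
  then show ?thesis using assms(2-4) that by blast
qed

lemma billiard_departs:
  assumes "billiard_trajectory B I T" "t \<in> I" "s \<in> I" "t < s"
  obtains v where "departs_with T t v"
proof -
  have "\<forall>t\<in>I. (\<exists>s\<in>I. t < s) \<longrightarrow> (\<exists>v. departs_with T t v)"
    using assms(1) by (simp add: billiard_trajectory_def)
  then show ?thesis using assms(2-4) that by blast
qed

lemma billiard_straight_unless_reflects:
  assumes "billiard_trajectory B I T" "t \<in> interior I" "\<And>k. \<not> reflects_at B T k t"
  obtains u where "arrives_with T t u" "departs_with T t u"
proof -
  have "(\<exists>u. arrives_with T t u \<and> departs_with T t u) \<or> (\<exists>k. reflects_at B T k t)"
    using assms(1,2) by (simp add: billiard_trajectory_def)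
  then show ?thesis using assms(3) that by blast
qed

lemma billiard_trajectory_subset:
  assumes T: "billiard_trajectory B J T" and "I \<subseteq> J" "is_interval I"
  shows "billiard_trajectory B I T"
  unfolding billiard_trajectory_def
proof (intro conjI ballI impI allI)
  show "T t \<notin> interior (lift_obst B k)" if "t \<in> I" for t k
    using T subsetD[OF assms(2) that] by (simp add: billiard_trajectory_def)
  show "\<exists>u. arrives_with T t u" if "t \<in> I" "\<exists>s\<in>I. s < t" for t
    using billiard_arrives[OF T] that assms(2) by (meson subsetD)
  show "\<exists>v. departs_with T t v" if "t \<in> I" "\<exists>s\<in>I. t < s" for t
    using billiard_departs[OF T] that assms(2) by (meson subsetD)
  show "(\<exists>u. arrives_with T t u \<and> departs_with T t u) \<or> (\<exists>k. reflects_at B T k t)"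
    if "t \<in> interior I" for t
    using T subsetD[OF interior_mono[OF assms(2)] that] by (simp add: billiard_trajectory_def)
qed fact

text \<open>Let \<open>c\<close> be the supremum of the times up to which the trajectory continues its departure from \<open>a\<close>
  along a straight line. It arrives at \<open>c\<close> with the same velocity, being affine just before \<open>c\<close>. If
  \<open>c\<close> came before \<open>b\<close>, it would also leave \<open>c\<close> with this velocity, as there is no reflection, and the
  straight line would continue beyond \<open>c\<close>.\<close>

lemma straight_between_reflections:
  assumes T: "billiard_trajectory B I T" and ab: "a < b" "{a..b} \<subseteq> I"
    and no: "\<And>t k. a < t \<Longrightarrow> t < b \<Longrightarrow> \<not> reflects_at B T k t"
  obtains d where "arrives_with T b d" "departs_with T a d" "T b - T a = (b - a) *\<^sub>R d"
proof -
  have "a \<in> I" "b \<in> I" using ab by auto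
  then obtain d where d: "departs_with T a d"
    using billiard_departs[OF T _ _ ab(1)] by blast
  define affine_upto where
    "affine_upto t \<longleftrightarrow> (\<forall>s. a \<le> s \<longrightarrow> s < t \<longrightarrow> T s = T a + (s - a) *\<^sub>R d)" for t
  define S where "S = {t. a < t \<and> t \<le> b \<and> affine_upto t}"
  have nd: "norm d = 1" using d by (simp add: departs_with_def)
  obtain b' where b': "b' > a" "\<And>s. a < s \<Longrightarrow> s < b' \<Longrightarrow> T s = T a + (s - a) *\<^sub>R d"
    using d by (rule departs_withE) blast
  have S1: "min b b' \<in> S"
  proof -
    have "T s = T a + (s - a) *\<^sub>R d" if "a \<le> s" "s < min b b'" for s
      using that b'(2)[of s] by (cases "s = a") auto
    then have "affine_upto (min b b')" unfolding affine_upto_def by blast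
    then show ?thesis using ab b'(1) by (simp add: S_def)
  qed
  have bdd: "bdd_above S" by (rule bdd_aboveI[of _ b]) (auto simp: S_def)
  define c where "c = Sup S"
  have "min b b' \<le> c" unfolding c_def by (rule cSup_upper[OF S1 bdd])
  then have ac: "a < c" using ab b'(1) by simp
  have cb: "c \<le> b"
    unfolding c_def
  proof (rule cSup_least)
    show "S \<noteq> {}" using S1 by blast
  qed (simp add: S_def)
  have below: "T s = T a + (s - a) *\<^sub>R d" if s: "a \<le> s" "s < c" for s
  proof -
    obtain t where "t \<in> S" "s < t"
      using less_cSupE[of s S] s(2) S1 unfolding c_def by blast
    then show ?thesis using s(1) unfolding S_def affine_upto_def by blast
  qed
  have "c \<in> I" using ac cb ab(2) by auto
  then obtain u where u: "arrives_with T c u"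
    using billiard_arrives[OF T _ \<open>a \<in> I\<close> ac] by blast
  obtain a' where a': "a' < c" "\<And>s. a' < s \<Longrightarrow> s < c \<Longrightarrow> T s = T c + (s - c) *\<^sub>R u"
    using u by (rule arrives_withE) blast
  define s1 where "s1 = (max a a' + c) / 2"
  define s2 where "s2 = (s1 + c) / 2"
  have s1: "a \<le> s1" "a' < s1" "s1 < c" using ac a'(1) by (auto simp: s1_def)
  have s2: "a \<le> s2" "a' < s2" "s2 < c" "s1 < s2" using s1 by (auto simp: s2_def)
  \<comment> \<open>Two affine parametrizations that agree at the two times s1 and s2 have the same velocity.\<close>
  have e1: "T c + (s1 - c) *\<^sub>R u = T a + (s1 - a) *\<^sub>R d" using below[of s1] a'(2)[of s1] s1 by simp
  have e2: "T c + (s2 - c) *\<^sub>R u = T a + (s2 - a) *\<^sub>R d" using below[of s2] a'(2)[of s2] s2 by simp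
  have "(T c + (s2 - c) *\<^sub>R u) - (T c + (s1 - c) *\<^sub>R u) = (s2 - s1) *\<^sub>R u"
    by (simp add: algebra_simps)
  moreover have "(T a + (s2 - a) *\<^sub>R d) - (T a + (s1 - a) *\<^sub>R d) = (s2 - s1) *\<^sub>R d"
    by (simp add: algebra_simps)
  ultimately have "(s2 - s1) *\<^sub>R u = (s2 - s1) *\<^sub>R d" using e1 e2 by simp
  then have ud: "u = d" using s2(4) by simp
  have Tc: "T c = T a + (c - a) *\<^sub>R d"
    using e1 unfolding ud by (simp add: algebra_simps)
  have "c = b"
  proof (rule ccontr)
    assume "c \<noteq> b"
    with cb have "c < b" by simp
    have "c \<in> interior I"
      using ac \<open>c < b\<close> ab(2) by (intro interiorI[of "{a<..<b}"]) auto
    then obtain u' where "arrives_with T c u'" "departs_with T c u'"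
      using no[OF ac \<open>c < b\<close>] by (rule billiard_straight_unless_reflects[OF T])
    then have "departs_with T c d" using arrives_with_unique[OF u] ud by blast
    then obtain e where e: "c < e" "\<And>s. c < s \<Longrightarrow> s < e \<Longrightarrow> T s = T c + (s - c) *\<^sub>R d"
      by (rule departs_withE) blast
    have "T s = T a + (s - a) *\<^sub>R d" if "a \<le> s" "s < min b e" for s
    proof (cases "s \<le> c")
      case True
      then show ?thesis using below[of s] Tc that by (cases "s = c") auto
    next
      case False
      then show ?thesis using e(2)[of s] Tc that by (simp add: algebra_simps)
    qed
    then have "affine_upto (min b e)" unfolding affine_upto_def by blast
    then have "min b e \<in> S" using e(1) \<open>c < b\<close> ac by (simp add: S_def)
    then have "min b e \<le> c" unfolding c_def by (rule cSup_upper[OF _ bdd])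
    then show False using e(1) \<open>c < b\<close> by simp
  qed
  then show ?thesis using that[of d] u ud d Tc by (simp add: algebra_simps)
qed

text \<open>Bounded reflection times would converge from below to some \<open>c\<close>; but the trajectory is affine on an
  interval that ends at \<open>c\<close>, where no reflections can happen.\<close>

lemma reflection_times_tendsto_infinity:
  assumes T: "billiard_trajectory B {0..} T" and mono: "\<And>n::nat. \<tau> n < \<tau> (Suc n)"
    and pos: "\<And>n. 0 \<le> \<tau> n" and refl: "\<And>n. reflects_at B T (\<kappa> n) (\<tau> n)"
  shows "filterlim \<tau> at_top sequentially"
proof (rule ccontr)
  assume no: "\<not> filterlim \<tau> at_top sequentially"
  have sm: "strict_mono \<tau>" using mono by (rule strict_mono_Suc_iff[THEN iffD2, rule_format])
  have bdd: "bdd_above (range \<tau>)"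
  proof (rule ccontr)
    assume unb: "\<not> bdd_above (range \<tau>)"
    have "\<forall>\<^sub>F n in sequentially. Z \<le> \<tau> n" for Z
    proof -
      obtain N where "Z < \<tau> N" using unb by (auto simp: bdd_above_def not_le)
      then have "Z \<le> \<tau> n" if "N \<le> n" for n
        using strict_mono_mono[OF sm] that by (meson less_le_trans less_imp_le monoD)
      then show ?thesis by (auto simp: eventually_sequentially)
    qed
    then have "filterlim \<tau> at_top sequentially" by (simp add: filterlim_at_top)
    then show False using no by simp
  qed
  define c where "c = Sup (range \<tau>)"
  have up: "\<tau> n < c" for n
  proof -
    have "\<tau> (Suc n) \<le> c" unfolding c_def by (rule cSup_upper[OF _ bdd]) simp
    then show ?thesis using mono[of n] by simp
  qed
  have "c > 0" using up[of 0] pos[of 0] by simp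
  then obtain u where u: "arrives_with T c u"
    using billiard_arrives[OF T, of c 0] by auto
  then have nu: "norm u = 1" by (simp add: arrives_with_def)
  obtain a where a: "a < c" "\<And>s. a < s \<Longrightarrow> s < c \<Longrightarrow> T s = T c + (s - c) *\<^sub>R u"
    using u by (rule arrives_withE) blast
  obtain n where "a < \<tau> n"
    using less_cSupE[of a "range \<tau>"] a(1) unfolding c_def by blast
  then have "\<not> reflects_at B T (\<kappa> n) (\<tau> n)"
    using affine_near_not_reflects_at[of a "\<tau> n" c u T "T c - c *\<^sub>R u"] up nu a(2)
    by (simp add: algebra_simps)
  then show False using refl by blast
qed

section \<open>Pieces of trajectories minimize length\<close>

text \<open>The velocity changes by a negative multiple of the outward normal, and the obstacle lies on the
  inner side of the tangent hyperplane.\<close>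

lemma reflection_velocity_change:
  assumes B: "convex B" "compact B" and refl: "reflects_at B T k t"
    and u: "arrives_with T t u" and v: "departs_with T t v" and y: "y \<in> lift_obst B k"
  shows "0 \<le> (u - v) \<bullet> (y - T t)"
proof -
  obtain \<nu> where \<nu>: "outward_unit_normal (lift_obst B k) (T t) \<nu>" "u \<bullet> \<nu> < 0"
    and v_eq: "v = u - (2 * (u \<bullet> \<nu>)) *\<^sub>R \<nu>"
    using refl arrives_with_unique[OF u] departs_with_unique[OF v] unfolding reflects_at_def by blast
  have "\<nu> \<bullet> (y - T t) \<le> 0"
    using outward_unit_normal_supports[OF \<nu>(1) _ _ y] B
    by (simp add: convex_lift_obst compact_lift_obst compact_imp_closed)
  then have "0 \<le> (2 * (u \<bullet> \<nu>)) * (\<nu> \<bullet> (y - T t))" using \<nu>(2) by (simp add: mult_nonpos_nonpos)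
  then show ?thesis by (simp add: v_eq)
qed

text \<open>The sum over the legs of \<open>d i \<bullet> (y (Suc i) - y i)\<close> is at most the length of \<open>y\<close>, with equality for
  \<open>y = x\<close>. Summation by parts turns the difference of the two sums into the sum of the terms in the
  hypothesis \<open>turn\<close>: this is the gradient inequality for the convex length function.\<close>

lemma broken_line_minimal:
  fixes x y d :: "nat \<Rightarrow> 'a::real_inner"
  assumes s: "1 \<le> s"
    and leg: "\<And>i. i < s \<Longrightarrow> x (Suc i) - x i = l i *\<^sub>R d i" "\<And>i. i < s \<Longrightarrow> norm (d i) = 1"
    and turn: "\<And>i. 1 \<le> i \<Longrightarrow> i < s \<Longrightarrow> 0 \<le> (d (i - 1) - d i) \<bullet> (y i - x i)"
    and ends: "y 0 = x 0" "y s = x s"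
  shows "(\<Sum>i<s. l i) \<le> (\<Sum>i<s. dist (y i) (y (Suc i)))"
proof -
  define e where "e i = y i - x i" for i
  have "d (n - 1) \<bullet> e n \<le> (\<Sum>i<n. d i \<bullet> (e (Suc i) - e i))" if "1 \<le> n" "n \<le> s" for n
    using that
  proof (induction n rule: dec_induct)
    case base
    then show ?case by (simp add: e_def ends)
  next
    case (step n)
    have "0 \<le> (d (n - 1) - d n) \<bullet> e n" using turn[of n] step by (simp add: e_def)
    then show ?case using step by (simp add: algebra_simps)
  qed
  from this[of s] have "0 \<le> (\<Sum>i<s. d i \<bullet> (e (Suc i) - e i))"
    using s by (simp add: e_def ends)
  moreover have "d i \<bullet> (e (Suc i) - e i) \<le> dist (y i) (y (Suc i)) - l i" if "i < s" for i
  proof -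
    have "e (Suc i) - e i = (y (Suc i) - y i) - (x (Suc i) - x i)" by (simp add: e_def)
    then have "d i \<bullet> (e (Suc i) - e i) = d i \<bullet> (y (Suc i) - y i) - l i"
      using leg[OF that] by (simp add: inner_diff_right dot_square_norm)
    moreover have "d i \<bullet> (y (Suc i) - y i) \<le> norm (d i) * norm (y (Suc i) - y i)"
      by (rule norm_cauchy_schwarz)
    ultimately show ?thesis using leg(2)[OF that] by (simp add: dist_norm norm_minus_commute)
  qed
  then have "(\<Sum>i<s. d i \<bullet> (e (Suc i) - e i)) \<le> (\<Sum>i<s. dist (y i) (y (Suc i)) - l i)"
    by (intro sum_mono) simp
  ultimately show ?thesis by (simp add: sum_subtractf)
qed

text \<open>The broken line is the trajectory itself, translated so that its type starts at the given lifts;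
  its vertices are the two endpoints and the reflections.\<close>

lemma piece_polygon:
  assumes B: "convex B" "compact B" and piece: "piece_has_type B T L s \<kappa>"
    and L: "0 < L" and s: "1 \<le> s"
  obtains x where "\<And>i. i \<le> s \<Longrightarrow> x i \<in> lift_obst B (\<kappa> i)" and "x s - x 0 = T L - T 0"
    and "(\<Sum>i<s. dist (x i) (x (Suc i))) = L"
    and "\<And>y. (\<And>i. i \<le> s \<Longrightarrow> y i \<in> lift_obst B (\<kappa> i)) \<Longrightarrow> y 0 = x 0 \<Longrightarrow> y s = x s \<Longrightarrow>
      L \<le> (\<Sum>i<s. dist (y i) (y (Suc i)))"
proof -
  obtain j \<tau> where T: "billiard_trajectory B {0..L} T"
    and T0: "T 0 \<in> frontier (lift_obst B (j + \<kappa> 0))"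
    and TL: "T L \<in> frontier (lift_obst B (j + \<kappa> s))"
    and \<tau>: "strict_mono_on {1..<s} \<tau>" "{t \<in> {0<..<L}. \<exists>k. reflects_at B T k t} = \<tau> ` {1..<s}"
    and refl: "\<And>n. n \<in> {1..<s} \<Longrightarrow> reflects_at B T (j + \<kappa> n) (\<tau> n)"
    using piece unfolding piece_has_type_def reflects_consecutively_def by blast
  define \<sigma> where "\<sigma> i = (if i = 0 then 0 else if s \<le> i then L else \<tau> i)" for i
  have \<sigma>_in: "0 < \<tau> i" "\<tau> i < L" if "i \<in> {1..<s}" for i
    using \<tau>(2) that by auto
  have mono: "\<sigma> i < \<sigma> (Suc i)" if "i < s" for i
    using that L \<sigma>_in[of i] \<sigma>_in[of "Suc i"] strict_mono_onD[OF \<tau>(1), of i "Suc i"]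
    by (auto simp: \<sigma>_def)
  have mono': "\<sigma> i < \<sigma> k" if "i < k" "k \<le> s" for i k
    using that
  proof (induction k rule: less_Suc_induct)
    case (1 i)
    then show ?case by (intro mono) simp
  qed auto
  have ran: "0 \<le> \<sigma> i" "\<sigma> i \<le> L" for i
    using L \<sigma>_in[of i] by (auto simp: \<sigma>_def)
  have "\<exists>d. arrives_with T (\<sigma> (Suc i)) d \<and> departs_with T (\<sigma> i) d \<and>
      T (\<sigma> (Suc i)) - T (\<sigma> i) = (\<sigma> (Suc i) - \<sigma> i) *\<^sub>R d" if i: "i < s" for i
  proof -
    have "\<not> reflects_at B T k t" if t: "\<sigma> i < t" "t < \<sigma> (Suc i)" for t k
    proof
      assume "reflects_at B T k t"
      moreover have "t \<in> {0<..<L}" using t ran[of i] ran[of "Suc i"] by auto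
      ultimately have "t \<in> \<tau> ` {1..<s}" using \<tau>(2) by blast
      then obtain n where n: "n \<in> {1..<s}" "t = \<sigma> n" by (auto simp: \<sigma>_def)
      have "n \<le> i \<or> Suc i \<le> n" by auto
      then show False
      proof
        assume "n \<le> i"
        then have "\<sigma> n \<le> \<sigma> i" using mono'[of n i] i by (cases "n = i") auto
        then show False using t(1) n(2) by simp
      next
        assume "Suc i \<le> n"
        then have "\<sigma> (Suc i) \<le> \<sigma> n" using mono'[of "Suc i" n] n(1) by (cases "n = Suc i") auto
        then show False using t(2) n(2) by simp
      qed
    qed
    moreover have "{\<sigma> i..\<sigma> (Suc i)} \<subseteq> {0..L}" using ran[of i] ran[of "Suc i"] by auto
    ultimately show ?thesis
      using straight_between_reflections[OF T mono[OF i]] by blast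
  qed
  then obtain d where d: "\<And>i. i < s \<Longrightarrow> arrives_with T (\<sigma> (Suc i)) (d i)"
    "\<And>i. i < s \<Longrightarrow> departs_with T (\<sigma> i) (d i)"
    "\<And>i. i < s \<Longrightarrow> T (\<sigma> (Suc i)) - T (\<sigma> i) = (\<sigma> (Suc i) - \<sigma> i) *\<^sub>R d i"
    by metis
  have nd: "norm (d i) = 1" if "i < s" for i using d(1)[OF that] by (simp add: arrives_with_def)
  define x where "x i = T (\<sigma> i) - lattice_point j" for i
  have lift: "z + lattice_point j \<in> lift_obst B (j + k) \<longleftrightarrow> z \<in> lift_obst B k" for z k
    using add_mem_lift_obst[of z j B k] by (simp add: add.commute)
  have fr: "z \<in> lift_obst B k" if "z \<in> frontier (lift_obst B k)" for z k
    using that compact_imp_closed[OF compact_lift_obst[OF B(2)]] by (auto simp: frontier_def)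
  have \<sigma>0: "\<sigma> 0 = 0" and \<sigma>s: "\<sigma> s = L" using s by (auto simp: \<sigma>_def)
  have refl': "reflects_at B T (j + \<kappa> i) (\<sigma> i)" if "1 \<le> i" "i < s" for i
    using refl[of i] that by (simp add: \<sigma>_def)
  have tsum: "(\<Sum>i<s. \<sigma> (Suc i) - \<sigma> i) = L" by (simp add: sum_lessThan_telescope \<sigma>0 \<sigma>s)
  show ?thesis
  proof
    show "x i \<in> lift_obst B (\<kappa> i)" if i: "i \<le> s" for i
    proof -
      have "T (\<sigma> i) \<in> frontier (lift_obst B (j + \<kappa> i))"
      proof (cases "1 \<le> i \<and> i < s")
        case True
        then show ?thesis
          using refl'[of i] by (auto simp: reflects_at_def outward_unit_normal_def)
      next
        case False
        then have "i = 0 \<or> i = s" using i by auto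
        then show ?thesis using T0 TL \<sigma>0 \<sigma>s by auto
      qed
      from fr[OF this] show ?thesis using lift[of "x i" "\<kappa> i"] by (simp add: x_def)
    qed
    show "x s - x 0 = T L - T 0" by (simp add: x_def \<sigma>0 \<sigma>s)
    have "dist (x i) (x (Suc i)) = \<sigma> (Suc i) - \<sigma> i" if "i < s" for i
    proof -
      have "dist (x i) (x (Suc i)) = norm (T (\<sigma> (Suc i)) - T (\<sigma> i))"
        by (simp add: x_def dist_norm norm_minus_commute)
      then show ?thesis using d(3)[OF that] nd[OF that] mono[OF that] by simp
    qed
    then show "(\<Sum>i<s. dist (x i) (x (Suc i))) = L" using tsum by simp
    show "L \<le> (\<Sum>i<s. dist (y i) (y (Suc i)))"
      if y: "\<And>i. i \<le> s \<Longrightarrow> y i \<in> lift_obst B (\<kappa> i)" and ends: "y 0 = x 0" "y s = x s" for y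
    proof -
      have "0 \<le> (d (i - 1) - d i) \<bullet> (y i - x i)" if i: "1 \<le> i" "i < s" for i
      proof -
        have "arrives_with T (\<sigma> i) (d (i - 1))" using d(1)[of "i - 1"] i by simp
        moreover have "y i + lattice_point j \<in> lift_obst B (j + \<kappa> i)" using y[of i] i lift[of "y i" "\<kappa> i"] by simp
        ultimately have "0 \<le> (d (i - 1) - d i) \<bullet> (y i + lattice_point j - T (\<sigma> i))"
          using reflection_velocity_change[OF B refl'[OF i]] d(2)[OF i(2)] by blast
        then show ?thesis by (simp add: x_def algebra_simps)
      qed
      moreover have "x (Suc i) - x i = (\<sigma> (Suc i) - \<sigma> i) *\<^sub>R d i" if "i < s" for i
        using d(3)[OF that] by (simp add: x_def)
      ultimately show ?thesis
        using broken_line_minimal[OF s, of x "\<lambda>i. \<sigma> (Suc i) - \<sigma> i" d y] nd ends tsum by simp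
    qed
  qed
qed

text \<open>A type with a single index forces a straight segment with both endpoints in one obstacle, so only
  short pieces have it.\<close>

lemma piece_without_legs_short:
  assumes B: "compact B" "B \<subseteq> cball 0 r" and piece: "piece_has_type B T L 0 \<kappa>"
  shows "L \<le> 2 * r"
proof (cases "L = 0")
  obtain j where T: "billiard_trajectory B {0..L} T" and L: "0 \<le> L"
    and T0: "T 0 \<in> frontier (lift_obst B (j + \<kappa> 0))"
    and TL: "T L \<in> frontier (lift_obst B (j + \<kappa> 0))"
    and none: "{t \<in> {0<..<L}. \<exists>k. reflects_at B T k t} = {}"
    using piece unfolding piece_has_type_def reflects_consecutively_def by auto
  have near: "norm (z - lattice_point k) \<le> r" if "z \<in> frontier (lift_obst B k)" for z k
  proof -
    have "z \<in> lift_obst B k"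
      using that compact_imp_closed[OF compact_lift_obst[OF B(1)]] by (auto simp: frontier_def)
    then show ?thesis using B(2) by (auto simp: mem_lift_obst)
  qed
  case False
  with L have "0 < L" by simp
  have "\<not> reflects_at B T k t" if "0 < t" "t < L" for t k
    using none that by auto
  then obtain d where "arrives_with T L d" "T L - T 0 = (L - 0) *\<^sub>R d"
    using straight_between_reflections[OF T \<open>0 < L\<close> order_refl] by blast
  then have "L = norm (T L - T 0)" using \<open>0 < L\<close> by (simp add: arrives_with_def)
  also have "\<dots> = norm ((T L - lattice_point (j + \<kappa> 0)) - (T 0 - lattice_point (j + \<kappa> 0)))"
    by simp
  also have "\<dots> \<le> r + r" by (intro norm_triangle_le_diff add_mono near T0 TL)
  finally show ?thesis by simp
next
  case True
  obtain j where "T 0 \<in> frontier (lift_obst B (j + \<kappa> 0))"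
    using piece unfolding piece_has_type_def by blast
  then have "T 0 \<in> lift_obst B (j + \<kappa> 0)"
    using compact_imp_closed[OF compact_lift_obst[OF B(1)]] by (auto simp: frontier_def)
  then have "norm (T 0 - lattice_point (j + \<kappa> 0)) \<le> r" using B(2) by (auto simp: mem_lift_obst)
  then have "0 \<le> r" by (rule order_trans[OF norm_ge_zero])
  then show ?thesis using True by simp
qed

section \<open>Periodic sequences indexed by the integers\<close>

lemma sum_periodic_shift:
  fixes f :: "int \<Rightarrow> real"
  assumes "\<And>i. f (i + int q) = f i"
  shows "(\<Sum>i<q. f (a + int i)) = (\<Sum>i<q. f (int i))"
proof -
  have step: "(\<Sum>i<q. f (a + 1 + int i)) = (\<Sum>i<q. f (a + int i))" for a
  proof -
    have "f a + (\<Sum>i<q. f (a + 1 + int i)) = (\<Sum>i<Suc q. f (a + int i))"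
      by (subst sum.lessThan_Suc_shift) (simp add: add.assoc)
    also have "\<dots> = (\<Sum>i<q. f (a + int i)) + f a" using assms[of a] by simp
    finally show ?thesis by simp
  qed
  show ?thesis
  proof (induction a rule: int_induct[of _ 0])
    case (step2 i)
    then show ?case using step[of "i - 1"] by simp
  qed (simp_all add: step)
qed

lemma cumulative_sum_int:
  fixes g :: "int \<Rightarrow> real"
  obtains \<tau> where "\<tau> 0 = 0" "\<And>i. \<tau> (i + 1) = \<tau> i + g i"
proof -
  define \<tau> where "\<tau> i = (if 0 \<le> i then \<Sum>j<nat i. g (int j) else - (\<Sum>j<nat (- i). g (- int j - 1)))" for i
  have "\<tau> 0 = 0" by (simp add: \<tau>_def)
  moreover have "\<tau> (i + 1) = \<tau> i + g i" for i
  proof (cases "0 \<le> i")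
    case True
    then have "nat (i + 1) = Suc (nat i)" by simp
    then show ?thesis using True by (simp add: \<tau>_def)
  next
    case False
    then have "nat (- i) = Suc (nat (- i - 1))" "int (nat (- i - 1)) = - i - 1" by auto
    then have "\<tau> i = - (\<Sum>j<nat (- i - 1). g (- int j - 1)) - g i"
      using False by (simp add: \<tau>_def)
    moreover have "- (i + 1) = - i - 1" by simp
    then have "\<tau> (i + 1) = - (\<Sum>j<nat (- i - 1). g (- int j - 1))"
      unfolding \<tau>_def using False by (cases "i = - 1") (simp_all only: if_False, simp_all)
    ultimately show ?thesis by simp
  qed
  ultimately show ?thesis by (rule that)
qed

text \<open>The value \<open>f t\<close> is the index of the interval of the partition that contains \<open>t\<close>.\<close>

lemma periodic_partition:
  fixes g :: "int \<Rightarrow> real"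
  assumes pos: "\<And>i. 0 < g i" and per: "\<And>i. g (i + int q) = g i" and q: "0 < q"
  obtains \<tau> f where "\<tau> 0 = 0" "\<And>i. \<tau> (i + 1) = \<tau> i + g i"
    "\<And>i. \<tau> (i + int q) = \<tau> i + (\<Sum>n<q. g (int n))"
    "\<And>i j. i < j \<Longrightarrow> \<tau> i < \<tau> j"
    "\<And>t. \<tau> (f t) \<le> t" "\<And>t. t < \<tau> (f t + 1)"
proof -
  obtain \<tau> where \<tau>0: "\<tau> 0 = 0" and \<tau>1: "\<And>i. \<tau> (i + 1) = \<tau> i + g i"
    using cumulative_sum_int[of g] by blast
  define \<Lambda> where "\<Lambda> = (\<Sum>n<q. g (int n))"
  have \<Lambda>: "0 < \<Lambda>" unfolding \<Lambda>_def using q by (intro sum_pos) (auto intro: pos)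
  have "\<tau> (i + int n) = \<tau> i + (\<Sum>k<n. g (i + int k))" for i n
  proof (induction n)
    case (Suc n)
    then show ?case using \<tau>1[of "i + int n"] by (simp add: algebra_simps)
  qed simp
  then have \<tau>q: "\<tau> (i + int q) = \<tau> i + \<Lambda>" for i
    using sum_periodic_shift[of g q i] per by (simp add: \<Lambda>_def)
  have mono: "\<tau> i < \<tau> j" if "i < j" for i j
    using that
  proof (induction j rule: int_gr_induct)
    case base
    then show ?case using \<tau>1[of i] pos[of i] by simp
  next
    case (step j)
    then show ?case using \<tau>1[of j] pos[of j] by simp
  qed
  have mult: "\<tau> (k * int q) = of_int k * \<Lambda>" for k
  proof (induction k rule: int_induct[of _ 0])
    case base
    then show ?case by (simp add: \<tau>0)
  next
    case (step1 k)
    then show ?case using \<tau>q[of "k * int q"] by (simp add: algebra_simps)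
  next
    case (step2 k)
    then show ?case using \<tau>q[of "(k - 1) * int q"] by (simp add: algebra_simps)
  qed
  have "\<exists>i. \<tau> i \<le> t \<and> t < \<tau> (i + 1)" for t
  proof -
    \<comment> \<open>The partition points with index a multiple of q are the multiples of the period, so only
      the q intervals between two such neighbours have to be searched.\<close>
    define k where "k = \<lfloor>t / \<Lambda>\<rfloor>"
    have k: "of_int k * \<Lambda> \<le> t" "t < of_int (k + 1) * \<Lambda>"
      using \<Lambda> by (simp_all add: k_def pos_le_divide_eq[symmetric] pos_divide_less_eq[symmetric])
    define S where "S = {i \<in> {k * int q..(k + 1) * int q}. \<tau> i \<le> t}"
    have S: "finite S" "k * int q \<in> S"
      using k(1) by (auto simp: S_def mult mult_right_mono intro: finite_subset[OF _ finite_atLeastAtMost])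
    define M where "M = Max S"
    have M: "M \<in> S" using Max_in[OF S(1)] S(2) unfolding M_def by blast
    have "t < \<tau> (M + 1)"
    proof (rule ccontr)
      assume c: "\<not> t < \<tau> (M + 1)"
      have "M \<noteq> (k + 1) * int q"
      proof
        assume "M = (k + 1) * int q"
        then have "\<tau> M = of_int (k + 1) * \<Lambda>" by (simp only: mult)
        then show False using k(2) M by (simp add: S_def)
      qed
      then have "M + 1 \<in> S" using M c by (auto simp: S_def)
      then have "M + 1 \<le> M" unfolding M_def by (rule Max_ge[OF S(1)])
      then show False by simp
    qed
    then show ?thesis using M by (auto simp: S_def)
  qed
  then obtain f where "\<And>t. \<tau> (f t) \<le> t" "\<And>t. t < \<tau> (f t + 1)" by metis
  then show ?thesis using that[OF \<tau>0 \<tau>1 \<tau>q[unfolded \<Lambda>_def] mono] by blast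
qed

text \<open>Subtracting the linear motion leaves a bounded periodic function.\<close>

lemma has_rotation_vector_of_quasiperiodic:
  fixes T :: "real \<Rightarrow> 'a::euclidean_space"
  assumes \<Lambda>: "0 < \<Lambda>" and per: "\<And>t. T (t + \<Lambda>) = T t + v"
    and bd: "\<And>t. 0 \<le> t \<Longrightarrow> t < \<Lambda> \<Longrightarrow> norm (T t) \<le> C"
  shows "has_rotation_vector T (v /\<^sub>R \<Lambda>)"
proof -
  define h where "h t = T t - (t / \<Lambda>) *\<^sub>R v" for t
  have hper: "h (t + \<Lambda>) = h t" for t
    using \<Lambda> by (simp add: h_def per add_divide_distrib scaleR_left_distrib)
  have hper': "h (t + real n * \<Lambda>) = h t" for t n
  proof (induction n)
    case (Suc n)
    then show ?case using hper[of "t + real n * \<Lambda>"] by (simp add: algebra_simps)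
  qed simp
  have hb: "norm (h t) \<le> C + norm v" if "0 \<le> t" for t
  proof -
    define n where "n = nat \<lfloor>t / \<Lambda>\<rfloor>"
    define r where "r = t - real n * \<Lambda>"
    have "real n = of_int \<lfloor>t / \<Lambda>\<rfloor>" using that \<Lambda> by (simp add: n_def)
    then have "real n \<le> t / \<Lambda>" "t / \<Lambda> < real n + 1" by linarith+
    then have "real n * \<Lambda> \<le> t" "t < real n * \<Lambda> + \<Lambda>"
      using \<Lambda> by (simp_all add: field_simps)
    then have r: "0 \<le> r" "r < \<Lambda>" by (simp_all add: r_def)
    have "h t = h r" using hper'[of r n] by (simp add: r_def)
    also have "norm (h r) \<le> norm (T r) + norm ((r / \<Lambda>) *\<^sub>R v)"
      unfolding h_def by (rule norm_triangle_ineq4)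
    also have "norm ((r / \<Lambda>) *\<^sub>R v) = (r / \<Lambda>) * norm v" using r \<Lambda> by simp
    also have "norm (T r) + (r / \<Lambda>) * norm v \<le> C + 1 * norm v"
      using bd[OF r] r \<Lambda> by (intro add_mono mult_right_mono) auto
    finally show ?thesis by simp
  qed
  have "((\<lambda>t. (h t - T 0) /\<^sub>R t) \<longlongrightarrow> 0) at_top"
  proof (rule Lim_null_comparison)
    show "\<forall>\<^sub>F t in at_top. norm ((h t - T 0) /\<^sub>R t) \<le> (C + norm v + norm (T 0)) / t"
      using eventually_gt_at_top[of 0]
    proof eventually_elim
      case (elim t)
      have "norm (h t - T 0) \<le> C + norm v + norm (T 0)"
        using hb[of t] elim by (intro norm_triangle_le_diff add_mono) auto
      then show ?case using elim by (simp add: divide_inverse mult.commute mult_left_mono)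
    qed
    show "((\<lambda>t. (C + norm v + norm (T 0)) / t) \<longlongrightarrow> 0) at_top"
      by (intro tendsto_divide_0[OF tendsto_const] filterlim_at_top_imp_at_infinity filterlim_ident)
  qed
  then have "((\<lambda>t. (h t - T 0) /\<^sub>R t + v /\<^sub>R \<Lambda>) \<longlongrightarrow> 0 + v /\<^sub>R \<Lambda>) at_top"
    by (intro tendsto_intros)
  moreover have "\<forall>\<^sub>F t in at_top. (h t - T 0) /\<^sub>R t + v /\<^sub>R \<Lambda> = (T t - T 0) /\<^sub>R t"
    using eventually_gt_at_top[of 0]
  proof eventually_elim
    case (elim t)
    then show ?case using \<Lambda> by (simp add: h_def algebra_simps inverse_eq_divide)
  qed
  ultimately show ?thesis
    unfolding has_rotation_vector_def using Lim_transform_eventually by fastforce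
qed

section \<open>Shortest closed chains are billiard orbits\<close>

text \<open>A bi-infinite admissible sequence that is periodic up to translation. The period is at least two so
  that moving one vertex of a closed chain leaves its two neighbours fixed.\<close>

locale periodic_itinerary =
  fixes B :: "(real ^ 'm) set" and K :: "int \<Rightarrow> int ^ 'm" and q :: nat and p :: "int ^ 'm"
  assumes obstacle: "obstacle B"
    and two_le_period: "2 \<le> q"
    and periodic: "K (i + int q) = K i + p"
    and step: "admissible_step B (K (i + 1) - K i)"
    and turn: "admissible_turn B (K (i + 1) - K i) (K (i + 2) - K (i + 1))"
begin

lemma compact_obstacle: "compact B" and convex_obstacle: "convex B"
  and smooth_obstacle: "smooth_boundary B"
  and disjoint_obstacles: "k \<noteq> l \<Longrightarrow> lift_obst B k \<inter> lift_obst B l = {}"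
  using obstacle unfolding obstacle_def strictly_convex_def by simp_all

lemma step_neq: "K (i + 1) \<noteq> K i"
  using step[of i] by (simp add: admissible_step_diff_iff)

lemma step_not_between: "\<not> between B k (K i) (K (i + 1))"
  using step[of i] by (simp add: admissible_step_diff_iff)

lemma turn_not_between: "\<not> between B (K (i + 1)) (K i) (K (i + 2))"
  using turn[of i] by (simp add: admissible_turn_diff_iff)

text \<open>Closed chains on the torus, lifted and continued periodically to all integers. Keeping all the
  vertices, instead of those of one period, makes all vertices equivalent.\<close>

definition chains :: "(int \<Rightarrow> real ^ 'm) set"
  where "chains = {X. (\<forall>i. X i \<in> lift_obst B (K i)) \<and> (\<forall>i. X (i + int q) = X i + lattice_point p)}"

definition chain_length :: "(int \<Rightarrow> real ^ 'm) \<Rightarrow> real"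
  where "chain_length X = (\<Sum>i<q. dist (X (int i)) (X (int i + 1)))"

lemma chains_mem: "X \<in> chains \<Longrightarrow> X i \<in> lift_obst B (K i)"
  and chains_periodic: "X \<in> chains \<Longrightarrow> X (i + int q) = X i + lattice_point p"
  by (auto simp: chains_def)

text \<open>The chains form a closed subset of a product of compact sets.\<close>

lemma shortest_chain_exists:
  obtains X where "X \<in> chains" "\<And>Y. Y \<in> chains \<Longrightarrow> chain_length X \<le> chain_length Y"
proof -
  have "compactin (product_topology (\<lambda>i::int. euclidean) UNIV) (PiE UNIV (\<lambda>i. lift_obst B (K i)))"
    by (simp add: compactin_PiE compact_lift_obst compact_obstacle)
  then have "compact (PiE UNIV (\<lambda>i. lift_obst B (K i)))"
    by (simp add: euclidean_product_topology)
  moreover have "closed {X :: int \<Rightarrow> real ^ 'm. \<forall>i. X (i + int q) = X i + lattice_point p}"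
    by (intro closed_Collect_all closed_Collect_eq continuous_intros) simp_all
  ultimately have "compact (PiE UNIV (\<lambda>i. lift_obst B (K i)) \<inter>
      {X. \<forall>i. X (i + int q) = X i + lattice_point p})"
    by (rule compact_Int_closed)
  also have "PiE UNIV (\<lambda>i. lift_obst B (K i)) \<inter> {X. \<forall>i. X (i + int q) = X i + lattice_point p} = chains"
    by (auto simp: chains_def)
  finally have "compact chains" .
  moreover have "chains \<noteq> {}"
  proof -
    obtain b where "b \<in> B" using obstacle interior_subset unfolding obstacle_def by blast
    then have "(\<lambda>i. b + lattice_point (K i)) \<in> chains"
      by (simp add: chains_def mem_lift_obst periodic lattice_point_add)
    then show ?thesis by blast
  qed
  moreover have "continuous_on chains chain_length"
    unfolding chain_length_def
    by (intro continuous_intros) (rule continuous_on_subset[OF continuous_on_product_coordinates subset_UNIV])+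
  ultimately show ?thesis using that by (meson continuous_attains_inf)
qed

text \<open>Vertices chosen over one period extend to a closed chain, as all other vertices are determined by
  translation.\<close>

lemma chain_through_vertices:
  assumes "\<And>n. n < q \<Longrightarrow> y n \<in> lift_obst B (K (int n))"
  obtains Y where "Y \<in> chains" "\<And>n. n < q \<Longrightarrow> Y (int n) = y n"
proof
  define Y where "Y i = y (nat (i mod int q)) + lattice_point (K i - K (i mod int q))" for i
  have q: "0 < q" using two_le_period by simp
  show "Y \<in> chains"
    unfolding chains_def
  proof (intro CollectI conjI allI)
    fix i
    define n where "n = nat (i mod int q)"
    have n: "int n = i mod int q" "n < q"
      using q by (simp_all add: n_def nat_less_iff)
    then have "y n - lattice_point (K (i mod int q)) \<in> B"
      using assms[of n] by (simp add: mem_lift_obst)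
    then show "Y i \<in> lift_obst B (K i)"
      by (simp add: Y_def n_def[symmetric] mem_lift_obst lattice_point_diff)
    show "Y (i + int q) = Y i + lattice_point p"
      by (simp add: Y_def periodic lattice_point_diff lattice_point_add)
  qed
  show "Y (int n) = y n" if "n < q" for n using that by (simp add: Y_def)
qed

lemma chain_length_shift:
  assumes "X \<in> chains"
  shows "chain_length X = (\<Sum>i<q. dist (X (a + int i)) (X (a + int i + 1)))"
proof -
  have "dist (X (i + int q)) (X (i + int q + 1)) = dist (X i) (X (i + 1))" for i
    using chains_periodic[OF assms, of i] chains_periodic[OF assms, of "i + 1"]
    by (simp add: algebra_simps)
  from sum_periodic_shift[of "\<lambda>i. dist (X i) (X (i + 1))" q a, OF this] show ?thesis
    by (simp add: chain_length_def)
qed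

text \<open>Moving one vertex, together with its translates, changes only the two adjacent legs. The length is
  computed over the period that starts one vertex earlier, so that both legs belong to it.\<close>

lemma shortest_chain_vertex_minimal:
  assumes X: "X \<in> chains" "\<And>Y. Y \<in> chains \<Longrightarrow> chain_length X \<le> chain_length Y"
    and y: "y \<in> lift_obst B (K n)"
  shows "dist (X (n - 1)) (X n) + dist (X n) (X (n + 1)) \<le> dist (X (n - 1)) y + dist y (X (n + 1))"
proof -
  \<comment> \<open>Membership of the translated vertices is immediate with a shift by K i - K n, which is a
    multiple of p by periodicity.\<close>
  define Y where "Y i = (if int q dvd i - n then y + lattice_point (K i - K n) else X i)" for i
  have Y: "Y \<in> chains"
    unfolding chains_def
  proof (intro CollectI conjI allI)
    fix i
    show "Y i \<in> lift_obst B (K i)"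
      using y chains_mem[OF X(1), of i] by (simp add: Y_def mem_lift_obst lattice_point_diff)
    have "int q dvd i + int q - n \<longleftrightarrow> int q dvd i - n"
      by (metis add_diff_eq diff_add_eq dvd_add_triv_right_iff)
    then show "Y (i + int q) = Y i + lattice_point p"
      by (simp add: Y_def periodic chains_periodic[OF X(1)] lattice_point_diff lattice_point_add)
  qed
  obtain q' where q': "q = Suc (Suc q')" using two_le_period by (metis add_2_eq_Suc le_Suc_ex)
  have split: "chain_length Z = dist (Z (n - 1)) (Z n) + dist (Z n) (Z (n + 1)) +
      (\<Sum>i<q'. dist (Z (n + 1 + int i)) (Z (n + 1 + int i + 1)))" if "Z \<in> chains" for Z
  proof -
    have "(\<Sum>i<q. f i) = f 0 + (f 1 + (\<Sum>i<q'. f (Suc (Suc i))))" for f :: "nat \<Rightarrow> real"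
      by (simp add: q' sum.lessThan_Suc_shift del: sum.lessThan_Suc)
    from this[of "\<lambda>i. dist (Z (n - 1 + int i)) (Z (n - 1 + int i + 1))"] show ?thesis
      unfolding chain_length_shift[OF that, of "n - 1"] by (simp add: algebra_simps)
  qed
  have Yn: "Y n = y" by (simp add: Y_def)
  have "\<not> int q dvd - 1" using two_le_period by (auto dest: zdvd_imp_le)
  then have Ypred: "Y (n - 1) = X (n - 1)" by (simp add: Y_def)
  have Ysucc: "Y (n + 1 + int i) = X (n + 1 + int i)" if "i \<le> q'" for i
  proof -
    have "\<not> int q dvd 1 + int i" using that q' by (auto dest: zdvd_imp_le)
    then show ?thesis by (simp add: Y_def algebra_simps)
  qed
  have "dist (Y (n + 1 + int i)) (Y (n + 1 + int i + 1)) =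
      dist (X (n + 1 + int i)) (X (n + 1 + int i + 1))" if "i < q'" for i
    using Ysucc[of i] Ysucc[of "Suc i"] that by (simp add: algebra_simps)
  then have "chain_length Y = dist (X (n - 1)) y + dist y (X (n + 1)) +
      (\<Sum>i<q'. dist (X (n + 1 + int i)) (X (n + 1 + int i + 1)))"
    using split[OF Y] Ypred Yn Ysucc[of 0] by simp
  then show ?thesis using X(2)[OF Y] split[OF X(1)] by simp
qed

lemma shortest_chain_reflects:
  assumes X: "X \<in> chains" "\<And>Y. Y \<in> chains \<Longrightarrow> chain_length X \<le> chain_length Y"
  obtains \<nu> where "outward_unit_normal (lift_obst B (K n)) (X n) \<nu>" "sgn (X n - X (n - 1)) \<bullet> \<nu> < 0"
    "sgn (X (n + 1) - X n) =
      sgn (X n - X (n - 1)) - (2 * (sgn (X n - X (n - 1)) \<bullet> \<nu>)) *\<^sub>R \<nu>"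
proof (rule reflection_at_minimum[of "lift_obst B (K n)" "X n" "X (n - 1)" "X (n + 1)"])
  show "convex (lift_obst B (K n))" by (rule convex_lift_obst[OF convex_obstacle])
  show "closed (lift_obst B (K n))"
    by (rule compact_imp_closed[OF compact_lift_obst[OF compact_obstacle]])
  show "smooth_boundary (lift_obst B (K n))" by (rule smooth_boundary_lift_obst[OF smooth_obstacle])
  show "X n \<in> lift_obst B (K n)" by (rule chains_mem[OF X(1)])
  show "X (n - 1) \<notin> lift_obst B (K n)"
    using chains_mem[OF X(1), of "n - 1"] step_neq[of "n - 1"] disjoint_obstacles[of "K n" "K (n - 1)"]
    by auto
  show "X (n + 1) \<notin> lift_obst B (K n)"
    using chains_mem[OF X(1), of "n + 1"] step_neq[of n] disjoint_obstacles[of "K n" "K (n + 1)"]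
    by auto
  have "X (n - 1) \<in> lift_obst B (K (n - 1))" "X (n + 1) \<in> lift_obst B (K (n + 1))"
    using chains_mem[OF X(1)] by blast+
  then have "closed_segment (X (n - 1)) (X (n + 1)) \<subseteq>
      convex hull (lift_obst B (K (n - 1)) \<union> lift_obst B (K (n + 1)))"
    unfolding segment_convex_hull by (intro hull_mono) auto
  moreover have "lift_obst B (K n) \<inter> convex hull (lift_obst B (K (n - 1)) \<union> lift_obst B (K (n + 1))) = {}"
  proof -
    have "n - 1 + 2 = n + 1" by simp
    then have "\<not> between B (K n) (K (n - 1)) (K (n + 1))"
      using turn_not_between[of "n - 1"] by (simp only: diff_add_cancel not_False_eq_True)
    moreover have "K n \<noteq> K (n - 1)" "K n \<noteq> K (n + 1)"
      using step_neq[of "n - 1"] step_neq[of n] by auto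
    ultimately show ?thesis by (simp add: between_def)
  qed
  ultimately show "closed_segment (X (n - 1)) (X (n + 1)) \<inter> lift_obst B (K n) = {}" by blast
  show "dist (X (n - 1)) (X n) + dist (X n) (X (n + 1)) \<le> dist (X (n - 1)) y + dist y (X (n + 1))"
    if "y \<in> lift_obst B (K n)" for y
    using shortest_chain_vertex_minimal[OF X that] .
qed (rule that)

text \<open>The two obstacles at the ends of a leg lie behind their tangent hyperplanes at its endpoints, and
  the leg leaves these hyperplanes transversally. All other obstacles miss the convex hull of the
  two obstacles, which contains the leg.\<close>

lemma shortest_chain_legs_avoid_interiors:
  assumes X: "X \<in> chains" "\<And>Y. Y \<in> chains \<Longrightarrow> chain_length X \<le> chain_length Y"
    and t: "0 \<le> t" "t \<le> dist (X n) (X (n + 1))"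
  shows "X n + t *\<^sub>R sgn (X (n + 1) - X n) \<notin> interior (lift_obst B k)"
proof
  define d where "d = sgn (X (n + 1) - X n)"
  define z where "z = X n + t *\<^sub>R d"
  assume "X n + t *\<^sub>R sgn (X (n + 1) - X n) \<in> interior (lift_obst B k)"
  then have z_int: "z \<in> interior (lift_obst B k)" by (simp add: z_def d_def)
  then have zk: "z \<in> lift_obst B k" using interior_subset by blast
  define l where "l = dist (X n) (X (n + 1))"
  have ld: "X (n + 1) = X n + l *\<^sub>R d"
  proof -
    have "l = norm (X (n + 1) - X n)" by (simp add: l_def dist_norm norm_minus_commute)
    then have "l *\<^sub>R d = X (n + 1) - X n" by (simp only: d_def norm_scaleR_sgn)
    then show ?thesis by simp
  qed
  have supp: "\<nu> \<bullet> (y - X i) \<le> 0"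
    if "outward_unit_normal (lift_obst B (K i)) (X i) \<nu>" "y \<in> lift_obst B (K i)" for i \<nu> y
    using outward_unit_normal_supports[OF that(1) convex_lift_obst[OF convex_obstacle] _ that(2)]
      compact_imp_closed[OF compact_lift_obst[OF compact_obstacle]] by blast
  consider "k = K n" | "k = K (n + 1)" | "k \<noteq> K n" "k \<noteq> K (n + 1)" by blast
  then show False
  proof cases
    case 1
    obtain \<nu> where \<nu>: "outward_unit_normal (lift_obst B (K n)) (X n) \<nu>" "sgn (X n - X (n - 1)) \<bullet> \<nu> < 0"
      "d = sgn (X n - X (n - 1)) - (2 * (sgn (X n - X (n - 1)) \<bullet> \<nu>)) *\<^sub>R \<nu>"
      unfolding d_def using shortest_chain_reflects[OF X, of n] .
    have "\<nu> \<bullet> \<nu> = 1" using norm_outward_unit_normal[OF \<nu>(1)] by (simp add: dot_square_norm)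
    then have "\<nu> \<bullet> d = - (sgn (X n - X (n - 1)) \<bullet> \<nu>)"
      by (simp add: \<nu>(3) inner_diff_right inner_commute)
    then have "0 < \<nu> \<bullet> d" using \<nu>(2) by simp
    moreover have "t * (\<nu> \<bullet> d) \<le> 0" using supp[OF \<nu>(1), of z] zk 1 by (simp add: z_def)
    ultimately have "t = 0" using t(1) by (metis mult_pos_pos not_less order_le_less)
    then have "X n \<in> interior (lift_obst B (K n))" using z_int 1 by (simp add: z_def)
    then show False using \<nu>(1) by (simp add: outward_unit_normal_def frontier_def)
  next
    case 2
    obtain \<nu> where \<nu>: "outward_unit_normal (lift_obst B (K (n + 1))) (X (n + 1)) \<nu>" "d \<bullet> \<nu> < 0"
      using shortest_chain_reflects[OF X, of "n + 1"] unfolding d_def by auto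
    have "z - X (n + 1) = (t - l) *\<^sub>R d" unfolding z_def ld by (simp add: algebra_simps)
    then have "\<nu> \<bullet> ((t - l) *\<^sub>R d) \<le> 0" using supp[OF \<nu>(1), of z] zk 2 by simp
    then have "(l - t) * - (\<nu> \<bullet> d) \<le> 0" by (simp add: algebra_simps)
    moreover have "0 < - (\<nu> \<bullet> d)" using \<nu>(2) by (simp add: inner_commute)
    moreover have "0 \<le> l - t" using t(2) by (simp add: l_def)
    ultimately have "l - t = 0" by (metis mult_pos_pos not_less order_le_less)
    then have "X (n + 1) \<in> interior (lift_obst B (K (n + 1)))" using z_int 2 by (simp add: z_def ld)
    then show False using \<nu>(1) by (simp add: outward_unit_normal_def frontier_def)
  next
    case 3
    have "0 < l" using chains_mem[OF X(1), of n] chains_mem[OF X(1), of "n + 1"] step_neq[of n]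
        disjoint_obstacles[of "K n" "K (n + 1)"] by (auto simp: l_def)
    have "z = (1 - t / l) *\<^sub>R X n + (t / l) *\<^sub>R X (n + 1)"
      unfolding z_def ld using \<open>0 < l\<close> by (simp add: algebra_simps)
    then have "z \<in> closed_segment (X n) (X (n + 1))"
      using t \<open>0 < l\<close> unfolding in_segment l_def by (intro exI[of _ "t / l"]) (simp add: l_def)
    also have "\<dots> \<subseteq> convex hull (lift_obst B (K n) \<union> lift_obst B (K (n + 1)))"
      unfolding segment_convex_hull using chains_mem[OF X(1), of n] chains_mem[OF X(1), of "n + 1"]
      by (intro hull_mono) auto
    finally show False using zk 3 step_not_between[of k n] by (auto simp: between_def)
  qed
qed

lemma chain_step_neq:
  assumes "X \<in> chains"
  shows "X i \<noteq> X (i + 1)"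
  using chains_mem[OF assms, of i] chains_mem[OF assms, of "i + 1"] step_neq[of i]
    disjoint_obstacles[of "K i" "K (i + 1)"] by auto

text \<open>The orbit runs through the chain with unit speed, so that its period is the length of the chain. Its
  velocity changes only at the vertices, where \<open>shortest_chain_reflects\<close> gives the law of reflection.\<close>

lemma shortest_chain_orbit:
  assumes X: "X \<in> chains" "\<And>Y. Y \<in> chains \<Longrightarrow> chain_length X \<le> chain_length Y"
    and K0: "K 0 = 0"
  obtains T where "admissible_periodic_orbit B T"
    "has_rotation_vector T (lattice_point p /\<^sub>R chain_length X)"
proof -
  define g where "g i = dist (X i) (X (i + 1))" for i
  define d where "d i = sgn (X (i + 1) - X i)" for i
  have Xq: "X (i + int q) = X i + lattice_point p" for i by (rule chains_periodic[OF X(1)])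
  have Xq1: "X (i + int q + 1) = X (i + 1) + lattice_point p" for i
    using Xq[of "i + 1"] by (simp add: algebra_simps)
  have g_pos: "0 < g i" for i using chain_step_neq[OF X(1)] by (simp add: g_def)
  have g_per: "g (i + int q) = g i" for i by (simp add: g_def Xq Xq1)
  have d_per: "d (i + int q) = d i" for i by (simp add: d_def Xq Xq1)
  have nd: "norm (d i) = 1" for i using chain_step_neq[OF X(1), of i] by (simp add: d_def norm_sgn)
  have "0 < q" using two_le_period by simp
  then obtain \<tau> f where \<tau>: "\<tau> 0 = 0" "\<And>i. \<tau> (i + 1) = \<tau> i + g i"
      "\<And>i. \<tau> (i + int q) = \<tau> i + (\<Sum>n<q. g (int n))" "\<And>i j. i < j \<Longrightarrow> \<tau> i < \<tau> j"
    and f: "\<And>t. \<tau> (f t) \<le> t" "\<And>t. t < \<tau> (f t + 1)"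
    using periodic_partition[of g q] g_pos g_per by metis
  define \<Lambda> where "\<Lambda> = chain_length X"
  have \<tau>q: "\<tau> (i + int q) = \<tau> i + \<Lambda>" for i
    using \<tau>(3) by (simp add: \<Lambda>_def chain_length_def g_def)
  have \<Lambda>: "0 < \<Lambda>" using \<tau>q[of 0] \<tau>(4)[of 0 "int q"] \<open>0 < q\<close> by (simp add: \<tau>(1))
  have \<tau>_le: "\<tau> i \<le> \<tau> j" if "i \<le> j" for i j using \<tau>(4)[of i j] that by (cases "i = j") auto
  have f_eq: "f t = i" if "\<tau> i \<le> t" "t < \<tau> (i + 1)" for t i
  proof (rule ccontr)
    assume "f t \<noteq> i"
    then have "f t + 1 \<le> i \<or> i + 1 \<le> f t" by auto
    then show False
      using \<tau>_le[of "f t + 1" i] \<tau>_le[of "i + 1" "f t"] f[of t] that by auto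
  qed
  define T where "T t = X (f t) + (t - \<tau> (f t)) *\<^sub>R d (f t)" for t
  have leg: "X (i + 1) = X i + g i *\<^sub>R d i" for i
  proof -
    have "g i = norm (X (i + 1) - X i)" by (simp add: g_def dist_norm norm_minus_commute)
    then have "g i *\<^sub>R d i = X (i + 1) - X i" by (simp only: d_def norm_scaleR_sgn)
    then show ?thesis by simp
  qed
  have T_leg: "T t = X i + (t - \<tau> i) *\<^sub>R d i" if t: "\<tau> i \<le> t" "t \<le> \<tau> (i + 1)" for t i
  proof (cases "t = \<tau> (i + 1)")
    case True
    then have "f t = i + 1" using \<tau>(4)[of "i + 1" "i + 1 + 1"] by (intro f_eq) auto
    then show ?thesis using True leg[of i] \<tau>(2)[of i] by (simp add: T_def)
  next
    case False
    then have "f t = i" using t by (intro f_eq) auto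
    then show ?thesis by (simp add: T_def)
  qed
  have T_vertex: "T (\<tau> i) = X i" for i using T_leg[of i "\<tau> i"] \<tau>_le[of i "i + 1"] by simp
  have arr: "arrives_with T t (d i)" if "\<tau> i < t" "t \<le> \<tau> (i + 1)" for t i
    using that T_leg[of i]
    by (intro affine_on_leftI[of "\<tau> i" t "d i" T "X i - \<tau> i *\<^sub>R d i"] nd)
       (auto simp: algebra_simps)
  have dep: "departs_with T t (d i)" if "\<tau> i \<le> t" "t < \<tau> (i + 1)" for t i
    using that T_leg[of i]
    by (intro affine_on_rightI[of t "\<tau> (i + 1)" "d i" T "X i - \<tau> i *\<^sub>R d i"] nd)
       (auto simp: algebra_simps)
  have refl: "reflects_at B T (K i) (\<tau> i)" for i
  proof -
    have "arrives_with T (\<tau> i) (d (i - 1))" using \<tau>(4)[of "i - 1" i] by (intro arr) auto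
    moreover have "departs_with T (\<tau> i) (d i)" using \<tau>(4)[of i "i + 1"] by (intro dep) auto
    moreover obtain \<nu> where "outward_unit_normal (lift_obst B (K i)) (X i) \<nu>"
      "sgn (X i - X (i - 1)) \<bullet> \<nu> < 0"
      "sgn (X (i + 1) - X i) = sgn (X i - X (i - 1)) - (2 * (sgn (X i - X (i - 1)) \<bullet> \<nu>)) *\<^sub>R \<nu>"
      using shortest_chain_reflects[OF X] .
    moreover have "d (i - 1) = sgn (X i - X (i - 1))" by (simp add: d_def)
    ultimately show ?thesis
      unfolding reflects_at_def T_vertex
      by (intro exI[of _ "d (i - 1)"] exI[of _ "d i"] exI[of _ \<nu>]) (simp add: d_def)
  qed
  have refl_time: "t = \<tau> (f t)" if "reflects_at B T k t" for t k
  proof (rule ccontr)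
    assume "t \<noteq> \<tau> (f t)"
    then have "\<tau> (f t) < t" using f(1)[of t] by simp
    then have "\<not> reflects_at B T k t"
      using f[of t] by (intro straight_not_reflects_at[of T t "d (f t)"] arr dep) auto
    then show False using that by simp
  qed
  have traj: "billiard_trajectory B UNIV T"
    unfolding billiard_trajectory_def
  proof (intro conjI ballI allI impI)
    show "T t \<notin> interior (lift_obst B k)" for t k
      unfolding T_def d_def using f[of t] \<tau>(2)[of "f t"]
      by (intro shortest_chain_legs_avoid_interiors[OF X]) (auto simp: g_def)
    have arr_ex: "\<exists>u. arrives_with T t u" for t
    proof (cases "t = \<tau> (f t)")
      case True
      then show ?thesis using refl[of "f t"] by (auto simp: reflects_at_def)
    next
      case False
      then show ?thesis using arr[of "f t" t] f[of t] by fastforce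
    qed
    then show "\<exists>u. arrives_with T t u" for t .
    show "\<exists>v. departs_with T t v" for t using dep[of "f t" t] f[of t] by blast
    show "(\<exists>u. arrives_with T t u \<and> departs_with T t u) \<or> (\<exists>k. reflects_at B T k t)" for t
    proof (cases "t = \<tau> (f t)")
      case True
      then show ?thesis using refl[of "f t"] by metis
    next
      case False
      then have "\<tau> (f t) < t" using f(1)[of t] by simp
      then show ?thesis using arr[of "f t" t] dep[of "f t" t] f[of t] by fastforce
    qed
  qed (simp add: is_interval_univ)
  have T_per: "T (t + \<Lambda>) = T t + lattice_point p" for t
  proof -
    have "f (t + \<Lambda>) = f t + int q"
      using f[of t] \<tau>q[of "f t"] \<tau>q[of "f t + 1"] by (intro f_eq) (auto simp: algebra_simps)
    then show ?thesis by (simp add: T_def \<tau>q Xq d_per)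
  qed
  have bound: "norm (T t) \<le> (\<Sum>i\<in>{0..int q}. norm (X i)) + \<Lambda>" if t: "0 \<le> t" "t < \<Lambda>" for t
  proof -
    have "0 < f t + 1" using f(2)[of t] t(1) \<tau>_le[of "f t + 1" 0] \<tau>(1) by force
    moreover have "f t < int q" using f(1)[of t] t(2) \<tau>_le[of "int q" "f t"] \<tau>q[of 0] \<tau>(1) by force
    ultimately have i: "f t \<in> {0..int q}" by auto
    have "norm (X (f t)) \<le> (\<Sum>i\<in>{0..int q}. norm (X i))"
      using i by (intro member_le_sum) auto
    moreover have "norm ((t - \<tau> (f t)) *\<^sub>R d (f t)) \<le> \<Lambda>"
      using f(1)[of t] t \<tau>_le[of 0 "f t"] i by (simp add: nd \<tau>(1))
    ultimately show ?thesis unfolding T_def by (intro norm_triangle_le add_mono)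
  qed
  have rot: "has_rotation_vector T (lattice_point p /\<^sub>R \<Lambda>)"
    using \<Lambda> T_per bound by (rule has_rotation_vector_of_quasiperiodic)
  define \<kappa> where "\<kappa> n = K (int n)" for n
  have "trajectory_has_type B T \<kappa>"
    unfolding trajectory_has_type_def reflects_consecutively_def
  proof (intro conjI exI[of _ 0] exI[of _ "\<lambda>n. \<tau> (int n)"])
    show "billiard_trajectory B {0..} T"
      using traj by (rule billiard_trajectory_subset) (auto simp: is_interval_ci)
    have "T 0 = X 0" using T_vertex[of 0] \<tau>(1) by simp
    then show "T 0 \<in> frontier (lift_obst B (0 + \<kappa> 0))"
      using shortest_chain_reflects[OF X, of 0] by (auto simp: \<kappa>_def outward_unit_normal_def)
    show "strict_mono_on {1..} (\<lambda>n. \<tau> (int n))" by (auto intro!: strict_mono_onI \<tau>(4))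
    show "\<forall>n\<in>{1..}. reflects_at B T (0 + \<kappa> n) (\<tau> (int n))" using refl by (simp add: \<kappa>_def)
    show "{t \<in> {0<..}. \<exists>k. reflects_at B T k t} = (\<lambda>n. \<tau> (int n)) ` {1..}"
    proof (intro equalityI subsetI)
      fix t assume "t \<in> {t \<in> {0<..}. \<exists>k. reflects_at B T k t}"
      then have "0 < t" "t = \<tau> (f t)" using refl_time by auto
      then have "0 < f t" using \<tau>_le[of "f t" 0] \<tau>(1) by force
      then have "f t = int (nat (f t))" "nat (f t) \<in> {1..}" by auto
      then show "t \<in> (\<lambda>n. \<tau> (int n)) ` {1..}" using \<open>t = \<tau> (f t)\<close> by (metis imageI)
    next
      fix t assume "t \<in> (\<lambda>n. \<tau> (int n)) ` {1..}"
      then obtain n where "1 \<le> n" "t = \<tau> (int n)" by auto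
      then show "t \<in> {t \<in> {0<..}. \<exists>k. reflects_at B T k t}"
        using refl[of "int n"] \<tau>(4)[of 0 "int n"] \<tau>(1) by auto
    qed
  qed
  moreover have "admissible B \<infinity> \<kappa>"
    unfolding admissible_iff_steps
  proof (intro conjI allI impI)
    show "\<kappa> 0 = 0" by (simp add: \<kappa>_def K0)
    show "admissible_step B (\<kappa> (n + 1) - \<kappa> n)" for n
      using step[of "int n"] by (simp add: \<kappa>_def add.commute)
    show "admissible_turn B (\<kappa> (n + 1) - \<kappa> n) (\<kappa> (n + 2) - \<kappa> (n + 1))" for n
      using turn[of "int n"] by (simp add: \<kappa>_def add.commute)
  qed
  moreover have "reflects_at B T (K 0) 0" using refl[of 0] \<tau>(1) by simp
  moreover have "periodic_orbit B T"
    unfolding periodic_orbit_def using traj T_per \<Lambda> by blast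
  ultimately have "admissible_periodic_orbit B T"
    unfolding admissible_periodic_orbit_def
    by (intro conjI exI[of _ "0 :: real"] exI[of _ "K 0"] exI[of _ \<kappa>]) simp_all
  then show ?thesis using that rot unfolding \<Lambda>_def by blast
qed

end

section \<open>Comparing pieces with periodic orbits\<close>

text \<open>Starting later changes displacement and time by constants only.\<close>

lemma has_rotation_vector_shift:
  assumes "has_rotation_vector T \<rho>"
  shows "has_rotation_vector (\<lambda>t. T (c + t)) \<rho>"
proof -
  have inv: "((\<lambda>t::real. inverse t) \<longlongrightarrow> 0) at_top"
    by (rule tendsto_inverse_0_at_top[OF filterlim_ident])
  have "filterlim (\<lambda>t. c + t) at_top at_top"
    by (rule filterlim_tendsto_add_at_top[OF tendsto_const filterlim_ident])
  then have lim: "((\<lambda>t. (T (c + t) - T 0) /\<^sub>R (c + t)) \<longlongrightarrow> \<rho>) at_top"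
    using assms unfolding has_rotation_vector_def by (rule filterlim_compose[rotated])
  have "((\<lambda>t. (1 + c * inverse t) *\<^sub>R ((T (c + t) - T 0) /\<^sub>R (c + t)) -
      inverse t *\<^sub>R (T c - T 0)) \<longlongrightarrow> (1 + c * 0) *\<^sub>R \<rho> - 0 *\<^sub>R (T c - T 0)) at_top"
    by (intro tendsto_intros lim inv)
  moreover have "\<forall>\<^sub>F t in at_top. (1 + c * inverse t) *\<^sub>R ((T (c + t) - T 0) /\<^sub>R (c + t)) -
      inverse t *\<^sub>R (T c - T 0) = (T (c + t) - T (c + 0)) /\<^sub>R t"
    using eventually_gt_at_top[of "max 0 (- c)"]
  proof eventually_elim
    case (elim t)
    then have "(1 + c * inverse t) * inverse (c + t) = inverse t" by (simp add: field_simps)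
    then show ?case by (simp add: scaleR_diff_right[symmetric])
  qed
  ultimately show ?thesis
    unfolding has_rotation_vector_def using Lim_transform_eventually by fastforce
qed

text \<open>The pieces of the orbit from a reflection to the later ones have admissible types, and their lengths
  tend to infinity.\<close>

lemma periodic_rotation_vector_in_admissible_rotation_set:
  assumes "admissible_periodic_orbit B T" "has_rotation_vector T \<rho>"
  shows "\<rho> \<in> admissible_rotation_set B"
proof -
  obtain t\<^sub>0 \<kappa> where type: "trajectory_has_type B (\<lambda>t. T (t\<^sub>0 + t)) \<kappa>" and adm: "admissible B \<infinity> \<kappa>"
    using assms(1) unfolding admissible_periodic_orbit_def by blast
  define T' where "T' t = T (t\<^sub>0 + t)" for t
  have rot: "has_rotation_vector T' \<rho>"
    using has_rotation_vector_shift[OF assms(2), of t\<^sub>0] by (simp add: T'_def[abs_def])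
  obtain j \<tau> where traj: "billiard_trajectory B {0..} T'"
    and T0: "T' 0 \<in> frontier (lift_obst B (j + \<kappa> 0))"
    and \<tau>: "strict_mono_on {1..} \<tau>" "{t \<in> {0<..}. \<exists>k. reflects_at B T' k t} = \<tau> ` {1..}"
    and refl: "\<And>n. 1 \<le> n \<Longrightarrow> reflects_at B T' (j + \<kappa> n) (\<tau> n)"
    using type unfolding trajectory_has_type_def reflects_consecutively_def T'_def[abs_def]
    by auto
  have \<tau>_less: "\<tau> i < \<tau> k \<longleftrightarrow> i < k" if "1 \<le> i" "1 \<le> k" for i k
    using strict_mono_on_less[OF \<tau>(1)] that by simp
  have \<tau>_pos: "0 < \<tau> n" if "1 \<le> n" for n using \<tau>(2) that by auto
  have lim: "filterlim (\<lambda>n. \<tau> (Suc n)) at_top sequentially"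
    using refl \<tau>_less \<tau>_pos
    by (intro reflection_times_tendsto_infinity[OF traj, of _ "\<lambda>n. j + \<kappa> (Suc n)"])
       (auto intro: less_imp_le)
  have piece: "piece_has_type B T' (\<tau> (Suc n)) (Suc n) \<kappa>" for n
    unfolding piece_has_type_def reflects_consecutively_def
  proof (intro conjI exI[of _ j] exI[of _ \<tau>])
    show "0 \<le> \<tau> (Suc n)" using \<tau>_pos[of "Suc n"] by simp
    show "billiard_trajectory B {0..\<tau> (Suc n)} T'"
      using traj by (rule billiard_trajectory_subset) (auto simp: is_interval_cc)
    show "T' 0 \<in> frontier (lift_obst B (j + \<kappa> 0))" by fact
    show "T' (\<tau> (Suc n)) \<in> frontier (lift_obst B (j + \<kappa> (Suc n)))"
      using refl[of "Suc n"] by (auto simp: reflects_at_def outward_unit_normal_def)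
    show "strict_mono_on {1..<Suc n} \<tau>"
      using \<tau>_less by (intro strict_mono_onI) simp
    show "\<forall>i\<in>{1..<Suc n}. reflects_at B T' (j + \<kappa> i) (\<tau> i)" using refl by simp
    have "{t \<in> {0<..<\<tau> (Suc n)}. \<exists>k. reflects_at B T' k t} = {t \<in> \<tau> ` {1..}. t < \<tau> (Suc n)}"
      unfolding \<tau>(2)[symmetric] by auto
    also have "\<dots> = \<tau> ` {1..<Suc n}" using \<tau>_less[of _ "Suc n"] by auto
    finally show "{t \<in> {0<..<\<tau> (Suc n)}. \<exists>k. reflects_at B T' k t} = \<tau> ` {1..<Suc n}" .
  qed
  have "admissible B (enat (Suc n)) \<kappa>" for n using adm by (simp add: admissible_def)
  moreover have "(\<lambda>n. (T' (\<tau> (Suc n)) - T' 0) /\<^sub>R \<tau> (Suc n)) \<longlonglongrightarrow> \<rho>"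
    using rot lim unfolding has_rotation_vector_def by (rule filterlim_compose)
  ultimately show ?thesis
    unfolding admissible_rotation_set_def using piece lim
    by (intro CollectI exI[of _ "\<lambda>_. T'"] exI[of _ "\<lambda>n. \<tau> (Suc n)"] exI[of _ Suc]
        exI[of _ "\<lambda>_. \<kappa>"]) simp
qed

lemma lift_obst_displacement:
  assumes "B \<subseteq> cball 0 r" "a \<in> lift_obst B k" "b \<in> lift_obst B l"
  shows "norm ((b - a) - lattice_point (l - k)) \<le> 2 * r"
proof -
  have "(b - a) - lattice_point (l - k) = (b - lattice_point l) - (a - lattice_point k)"
    by (simp add: lattice_point_diff)
  also have "norm \<dots> \<le> r + r"
  proof (rule norm_triangle_le_diff, rule add_mono)
    show "norm (b - lattice_point l) \<le> r" "norm (a - lattice_point k) \<le> r"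
      using assms by (auto simp: mem_lift_obst)
  qed
  finally show ?thesis by simp
qed

text \<open>The constants come from \<open>2 * r \<le> 1\<close>: an obstacle has diameter at most \<open>1\<close>, hence each of the three
  new legs has length at most \<open>2\<close>, which gives \<open>\<Lambda> \<le> L + 6\<close>, and the displacements differ by at most
  \<open>3 + 1\<close>. Moving the endpoints of the orbit to those of the piece costs at most \<open>2\<close>; the bound \<open>6\<close>
  is used in this direction too.\<close>

lemma admissible_piece_shadowed_by_periodic_orbit:
  fixes B :: "(real ^ 'm) set"
  assumes dim: "CARD('m) \<ge> 2" and obs: "obstacle B" and r: "B \<subseteq> cball 0 r" "r < sqrt 2 / 4"
    and piece: "piece_has_type B T L s \<kappa>" and adm: "admissible B (enat s) \<kappa>"
    and L: "0 < L" and s: "1 \<le> s"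
  obtains T' v \<Lambda> where "admissible_periodic_orbit B T'" "has_rotation_vector T' (v /\<^sub>R \<Lambda>)"
    "\<bar>\<Lambda> - L\<bar> \<le> 6" "norm (v - (T L - T 0)) \<le> 4"
proof -
  have B: "convex B" "compact B" using obs by (auto simp: obstacle_def strictly_convex_def)
  have "sqrt 2 < 2" by (simp add: real_less_lsqrt)
  then have r_le: "r \<le> 1 / 2" using r(2) by simp
  obtain x where x: "\<And>i. i \<le> s \<Longrightarrow> x i \<in> lift_obst B (\<kappa> i)" "x s - x 0 = T L - T 0"
      "(\<Sum>i<s. dist (x i) (x (Suc i))) = L"
    and x_min: "\<And>y. (\<And>i. i \<le> s \<Longrightarrow> y i \<in> lift_obst B (\<kappa> i)) \<Longrightarrow> y 0 = x 0 \<Longrightarrow> y s = x s \<Longrightarrow>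
      L \<le> (\<Sum>i<s. dist (y i) (y (Suc i)))"
    using piece_polygon[OF B piece L s] by blast
  obtain K p where K: "\<And>n. n \<le> s \<Longrightarrow> K (int n) = \<kappa> n" "\<And>i. K (i + int (s + 3)) = K i + p"
      "\<And>i. admissible_step B (K (i + 1) - K i)"
      "\<And>i. admissible_turn B (K (i + 1) - K i) (K (i + 2) - K (i + 1))"
    and unit: "\<And>n. n \<in> {s..<s + 3} \<Longrightarrow> norm (lattice_point (K (int n + 1) - K (int n))) = 1"
    using admissible_closing[OF dim B(1) r s adm] by blast
  interpret periodic_itinerary B K "s + 3" p
    by unfold_locales (use obs K in auto)
  obtain X where X: "X \<in> chains" "\<And>Y. Y \<in> chains \<Longrightarrow> chain_length X \<le> chain_length Y"
    using shortest_chain_exists by blast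
  define \<Lambda> where "\<Lambda> = chain_length X"
  have x_K: "x i \<in> lift_obst B (K (int i))" if "i \<le> s" for i using x(1)[OF that] K(1)[OF that] by simp
  have split3: "(\<Sum>i<s + 3. h i) = (\<Sum>i<s. h i) + h s + h (s + 1) + h (s + 2)" for h :: "nat \<Rightarrow> real"
    by (simp add: numeral_3_eq_3)
  \<comment> \<open>The vertices of the piece, followed by translates of its last one, form a closed chain.\<close>
  have "\<Lambda> \<le> L + 6"
  proof -
    define y where "y n = (if n \<le> s then x n else x s + lattice_point (K (int n) - K (int s)))" for n
    have "y n \<in> lift_obst B (K (int n))" for n
      using x_K[of n] x_K[of s] by (auto simp: y_def mem_lift_obst lattice_point_diff)
    then obtain Y where Y: "Y \<in> chains" "\<And>n. n < s + 3 \<Longrightarrow> Y (int n) = y n"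
      using chain_through_vertices[of y] by blast
    have old: "dist (Y (int i)) (Y (int i + 1)) = dist (x i) (x (Suc i))" if "i < s" for i
      using Y(2)[of i] Y(2)[of "Suc i"] that by (simp add: y_def add.commute)
    have new: "dist (Y (int i)) (Y (int i + 1)) \<le> 2" if "i \<in> {s..<s + 3}" for i
    proof -
      define w where "w = lattice_point (K (int i + 1) - K (int i))"
      have "norm ((Y (int i + 1) - Y (int i)) - w) \<le> 2 * r"
        unfolding w_def using chains_mem[OF Y(1)] by (intro lift_obst_displacement[OF r(1)])
      moreover have "norm w = 1" using unit[OF that] by (simp add: w_def)
      moreover have "norm (Y (int i + 1) - Y (int i)) \<le> norm ((Y (int i + 1) - Y (int i)) - w) + norm w"
        using norm_triangle_ineq[of "(Y (int i + 1) - Y (int i)) - w" w] by simp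
      ultimately show ?thesis using r_le by (simp add: dist_norm norm_minus_commute)
    qed
    have "chain_length Y = (\<Sum>i<s. dist (x i) (x (Suc i))) + dist (Y (int s)) (Y (int s + 1)) +
        dist (Y (int (s + 1))) (Y (int (s + 1) + 1)) + dist (Y (int (s + 2))) (Y (int (s + 2) + 1))"
      unfolding chain_length_def split3 using old by simp
    also have "\<dots> \<le> L + 2 + 2 + 2"
      unfolding x(3) by (intro add_mono order_refl new) auto
    finally show ?thesis using X(2)[OF Y(1)] by (simp add: \<Lambda>_def)
  qed
  \<comment> \<open>The orbit, with its first and last vertex replaced by the endpoints of the piece, is a
    competitor of the piece.\<close>
  moreover have "L \<le> \<Lambda> + 6"
  proof -
    define y where "y i = (if i = 0 then x 0 else if i = s then x s else X (int i))" for i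
    have y0: "y 0 = x 0" and ys: "y s = x s" using s by (auto simp: y_def)
    have y_K: "y i \<in> lift_obst B (K (int i))" if "i \<le> s" for i
      using x_K[of 0] x_K[of s] chains_mem[OF X(1), of "int i"] by (auto simp: y_def)
    then have "L \<le> (\<Sum>i<s. dist (y i) (y (Suc i)))"
      using K(1) y0 ys by (intro x_min) auto
    also have "\<dots> \<le> (\<Sum>i<s. dist (X (int i)) (X (int i + 1)) + (if i = 0 then 1 else 0) +
        (if i = s - 1 then 1 else 0))"
    proof (rule sum_mono)
      fix i assume "i \<in> {..<s}"
      have near: "dist (y n) (X (int n)) \<le> (if n = 0 \<or> n = s then 1 else 0)" if "n \<le> s" for n
        using lift_obst_displacement[OF r(1) chains_mem[OF X(1), of "int n"] y_K[OF that]] r_le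
        by (auto simp: dist_norm y_def)
      have "dist (y i) (y (Suc i)) \<le> dist (y i) (X (int i)) + dist (X (int i)) (X (int (Suc i))) +
          dist (X (int (Suc i))) (y (Suc i))"
        using dist_triangle[of "y i" "y (Suc i)" "X (int i)"]
          dist_triangle[of "X (int i)" "y (Suc i)" "X (int (Suc i))"] by simp
      moreover have "dist (y i) (X (int i)) \<le> (if i = 0 then 1 else 0)"
        using near[of i] \<open>i \<in> {..<s}\<close> by auto
      moreover have "dist (X (int (Suc i))) (y (Suc i)) \<le> (if i = s - 1 then 1 else 0)"
      proof -
        have "Suc i = s \<longleftrightarrow> i = s - 1" using s by auto
        then show ?thesis
          using near[of "Suc i"] \<open>i \<in> {..<s}\<close> by (simp only: dist_commute) simp
        qed
      ultimately show "dist (y i) (y (Suc i)) \<le> dist (X (int i)) (X (int i + 1)) +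
          (if i = 0 then 1 else 0) + (if i = s - 1 then 1 else 0)"
        by (simp add: add.commute)
    qed
    also have "\<dots> = (\<Sum>i<s. dist (X (int i)) (X (int i + 1))) + 2"
      using s by (simp add: sum.distrib)
    also have "(\<Sum>i<s. dist (X (int i)) (X (int i + 1))) \<le> \<Lambda>"
      unfolding \<Lambda>_def chain_length_def by (intro sum_mono2) auto
    finally show ?thesis by simp
  qed
  ultimately have len: "\<bar>\<Lambda> - L\<bar> \<le> 6" by simp
  have disp: "norm (lattice_point p - (T L - T 0)) \<le> 4"
  proof -
    define w where "w n = lattice_point (K (int n + 1) - K (int n))" for n
    have "lattice_point p = lattice_point (K (int (s + 3))) - lattice_point (K 0)"
      unfolding lattice_point_diff[symmetric] using K(2)[of 0] by simp
    then have "lattice_point p =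
        lattice_point (K (int s) - K 0) + w s + w (s + 1) + w (s + 2)"
      by (simp add: w_def lattice_point_diff algebra_simps)
    then have "lattice_point p - (T L - T 0) =
        w s + w (s + 1) + w (s + 2) - ((x s - x 0) - lattice_point (K (int s) - K (int 0)))"
      unfolding x(2)[symmetric] by simp
    also have "norm \<dots> \<le> (1 + 1 + 1) + 2 * r"
    proof (rule norm_triangle_le_diff, rule add_mono)
      have "norm (w n) \<le> 1" if "n \<in> {s..<s + 3}" for n using unit[OF that] by (simp add: w_def)
      then show "norm (w s + w (s + 1) + w (s + 2)) \<le> 1 + 1 + 1"
        by (intro norm_triangle_le add_mono) auto
      show "norm ((x s - x 0) - lattice_point (K (int s) - K (int 0))) \<le> 2 * r"
        using x_K[of 0] x_K[of s] by (intro lift_obst_displacement[OF r(1)]) simp_all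
    qed
    finally show ?thesis using r_le by simp
  qed
  have "K 0 = 0" using K(1)[of 0] adm by (simp add: admissible_def)
  then obtain T' where "admissible_periodic_orbit B T'"
    "has_rotation_vector T' (lattice_point p /\<^sub>R \<Lambda>)"
    using shortest_chain_orbit[OF X] unfolding \<Lambda>_def by blast
  then show ?thesis using that len disp by blast
qed

theorem theorem3p2:
  fixes B :: "(real ^ 'm) set"
  assumes "CARD('m) \<ge> 2"
    and "small_obstacle B"
  shows "{\<rho>. \<exists>T. admissible_periodic_orbit B T \<and> has_rotation_vector T \<rho>} \<subseteq> admissible_rotation_set B \<and>
    admissible_rotation_set B \<subseteq> closure {\<rho>. \<exists>T. admissible_periodic_orbit B T \<and> has_rotation_vector T \<rho>}"
proof
  show "{\<rho>. \<exists>T. admissible_periodic_orbit B T \<and> has_rotation_vector T \<rho>} \<subseteq> admissible_rotation_set B"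
    using periodic_rotation_vector_in_admissible_rotation_set by blast
  obtain r where obs: "obstacle B" and r: "r < sqrt 2 / 4" "B \<subseteq> cball 0 r"
    using assms(2) unfolding small_obstacle_def by blast
  show "admissible_rotation_set B \<subseteq>
      closure {\<rho>. \<exists>T. admissible_periodic_orbit B T \<and> has_rotation_vector T \<rho>}"
  proof
    fix \<rho> assume "\<rho> \<in> admissible_rotation_set B"
    then obtain T L s \<kappa> where
      piece: "\<And>n. piece_has_type B (T n) (L n) (s n) (\<kappa> n)"
      and adm: "\<And>n. admissible B (enat (s n)) (\<kappa> n)"
      and L: "filterlim L at_top sequentially"
      and lim: "(\<lambda>n::nat. (T n (L n) - T n 0) /\<^sub>R L n) \<longlonglongrightarrow> \<rho>"
      unfolding admissible_rotation_set_def by blast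
    show "\<rho> \<in> closure {\<rho>. \<exists>T. admissible_periodic_orbit B T \<and> has_rotation_vector T \<rho>}"
      unfolding closure_approachable
    proof (intro allI impI)
      fix e :: real assume e: "0 < e"
      define C where "C = 4 + (norm \<rho> + 1) * 6"
      have "\<forall>\<^sub>F n in sequentially. dist ((T n (L n) - T n 0) /\<^sub>R L n) \<rho> < min 1 (e / 2)"
        using lim e by (intro tendstoD) auto
      moreover have "\<forall>\<^sub>F n in sequentially. max (2 * r) 6 + 2 * C / e < L n"
        using L by (simp add: filterlim_at_top_dense)
      ultimately have "\<forall>\<^sub>F n in sequentially.
          dist ((T n (L n) - T n 0) /\<^sub>R L n) \<rho> < min 1 (e / 2) \<and> max (2 * r) 6 + 2 * C / e < L n"
        by (rule eventually_conj)
      then obtain n where n: "dist ((T n (L n) - T n 0) /\<^sub>R L n) \<rho> < min 1 (e / 2)"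
        "max (2 * r) 6 + 2 * C / e < L n"
        using eventually_happens'[OF sequentially_bot] by blast
      define l where "l = L n"
      define \<Delta> where "\<Delta> = T n l - T n 0"
      have "0 < C" by (simp add: C_def add_pos_nonneg)
      then have Ce: "0 < 2 * C / e" using e by simp
      then have l: "6 + 2 * C / e < l" "2 * r < l" "0 < l" using n(2) by (auto simp: l_def)
      \<comment> \<open>A type with a single index cannot be closed up, but belongs only to short pieces.\<close>
      have "s n \<noteq> 0"
      proof
        assume "s n = 0"
        then have "l \<le> 2 * r"
          using piece_without_legs_short[of B r "T n" l "\<kappa> n"] piece[of n] obs r(2)
          by (simp add: l_def obstacle_def)
        then show False using l(2) by simp
      qed
      then have "1 \<le> s n" by simp
      obtain T' v \<Lambda> where orbit: "admissible_periodic_orbit B T'" "has_rotation_vector T' (v /\<^sub>R \<Lambda>)"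
        and close: "\<bar>\<Lambda> - l\<bar> \<le> 6" "norm (v - \<Delta>) \<le> 4"
        using admissible_piece_shadowed_by_periodic_orbit[OF assms(1) obs r(2,1) piece[of n] adm[of n]
            l(3)[unfolded l_def] \<open>1 \<le> s n\<close>]
        unfolding l_def \<Delta>_def by blast
      have \<Lambda>: "2 * C / e < \<Lambda>" "0 < \<Lambda>" using close(1) l(1) Ce by auto
      have "norm (\<Delta> /\<^sub>R l) \<le> norm \<rho> + 1"
        using n(1) norm_triangle_ineq2[of "\<Delta> /\<^sub>R l" \<rho>] by (simp add: dist_norm l_def \<Delta>_def)
      \<comment> \<open>The numerator on the right is bounded and the period tends to infinity with the length.\<close>
      moreover have "v /\<^sub>R \<Lambda> - \<Delta> /\<^sub>R l = (v - \<Delta> + (l - \<Lambda>) *\<^sub>R (\<Delta> /\<^sub>R l)) /\<^sub>R \<Lambda>"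
        using \<Lambda>(2) l(3) by (simp add: algebra_simps)
      moreover have "norm (v - \<Delta> + (l - \<Lambda>) *\<^sub>R (\<Delta> /\<^sub>R l)) \<le> 4 + 6 * norm (\<Delta> /\<^sub>R l)"
      proof (rule norm_triangle_le, rule add_mono)
        have "norm ((l - \<Lambda>) *\<^sub>R (\<Delta> /\<^sub>R l)) = \<bar>\<Lambda> - l\<bar> * norm (\<Delta> /\<^sub>R l)"
          by (simp only: norm_scaleR abs_minus_commute)
        also have "\<dots> \<le> 6 * norm (\<Delta> /\<^sub>R l)"
          using close(1) by (rule mult_right_mono) simp
        finally show "norm ((l - \<Lambda>) *\<^sub>R (\<Delta> /\<^sub>R l)) \<le> 6 * norm (\<Delta> /\<^sub>R l)" .
      qed (rule close(2))
      ultimately have "norm (v /\<^sub>R \<Lambda> - \<Delta> /\<^sub>R l) \<le> C / \<Lambda>"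
        using \<Lambda>(2) by (simp add: C_def divide_inverse mult.commute mult_left_mono)
      also have "C / \<Lambda> < e / 2" using \<Lambda> e by (simp add: field_simps)
      finally have "dist (v /\<^sub>R \<Lambda>) (\<Delta> /\<^sub>R l) < e / 2" by (simp add: dist_norm)
      moreover have "dist (\<Delta> /\<^sub>R l) \<rho> < e / 2" using n(1) by (simp add: l_def \<Delta>_def)
      ultimately have "dist (v /\<^sub>R \<Lambda>) \<rho> < e"
        using dist_triangle[of "v /\<^sub>R \<Lambda>" \<rho> "\<Delta> /\<^sub>R l"] by simp
      then show "\<exists>y\<in>{\<rho>. \<exists>T. admissible_periodic_orbit B T \<and> has_rotation_vector T \<rho>}. dist y \<rho> < e"
        using orbit by blast
    qed
  qed
qed

end
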